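(* For every bridgeless graph $G$ with radius $r$ and $\zeta=iso(G)$, $$rc(G)\le \sum_{i=1}^{r}\min\{2i+1,\zeta\}\le r\zeta.$$ Moreover, for every two integers $r\ge 1$ and $3\le\zeta\le 2r+1$, there exists a bridgeless graph $G$ with radius $r$ and $iso(G)=\zeta$ such that $rc(G)=\sum_{i=1}^{r}\min\{2i+1,\zeta\}$.
   Context: All graphs are finite, simple and undirected. A bridgeless graph is a connected graph with no bridge (an edge whose removal disconnects the graph). The radius of a connected graph is $\min_{v}\max_{x} d_G(v,x)$. An edge colouring is a rainbow colouring if every pair of vertices is joined by a path whose edges have pairwise distinct colours; $rc(G)$, the rainbow connection number, is the minimum number of colours in a rainbow colouring of $G$. A subgraph $H$ of $G$ is isometric if distances between vertices of $H$ are the same in $H$ as in $G$; $iso(G)$ is the length of a largest isometric cycle of $G$. *)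

theory Defs
  imports "Graph_Theory.Graph_Theory"
begin

text \<open>
  A finite simple undirected graph is a \<open>pair_graph\<close>: a finite, symmetric, loop-free set of
  ordered pairs. An undirected edge between \<open>u\<close> and \<open>v\<close> is thus the pair of arcs \<open>(u, v)\<close>,
  \<open>(v, u)\<close>; for colouring it is the two-element set \<open>{u, v}\<close>.
\<close>

definition edges :: "'a pair_pre_digraph \<Rightarrow> 'a set set" where
  "edges G = (\<lambda>(u, v). {u, v}) ` parcs G"

definition remove_edge :: "'a pair_pre_digraph \<Rightarrow> 'a \<Rightarrow> 'a \<Rightarrow> 'a pair_pre_digraph" where
  "remove_edge G u v = \<lparr>pverts = pverts G, parcs = parcs G - {(u, v), (v, u)}\<rparr>"

definition bridge :: "'a pair_pre_digraph \<Rightarrow> 'a \<Rightarrow> 'a \<Rightarrow> bool" where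
  "bridge G u v \<longleftrightarrow> (u, v) \<in> parcs G \<and> \<not> connected (remove_edge G u v)"

definition bridgeless_graph :: "'a pair_pre_digraph \<Rightarrow> bool" where
  "bridgeless_graph G \<longleftrightarrow> pair_graph G \<and> connected G \<and> (\<forall>u v. \<not> bridge G u v)"

text \<open>
  Since \<open>Inf {} = 0\<close> on \<open>nat\<close>, this is the usual distance only for \<open>u\<close> and \<open>v\<close> in the same
  component.
\<close>

definition gdist :: "'a pair_pre_digraph \<Rightarrow> 'a \<Rightarrow> 'a \<Rightarrow> nat" where
  "gdist G u v = Inf {length p | p. pre_digraph.awalk G u p v}"

lemma (in wf_digraph) awalk_cost_unit: "awalk_cost (\<lambda>_. 1) p = real (length p)"
  by (induction p) simp_all

lemma gdist_eq_\<mu>: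
  assumes G: "pair_graph G" and uv: "u \<rightarrow>\<^sup>*\<^bsub>G\<^esub> v"
  shows "ereal (real (gdist G u v)) = wf_digraph.\<mu> G (\<lambda>_. 1) u v"
proof -
  interpret pair_graph G by (fact G)
  let ?S = "{length p | p. awalk u p v}"
  have "?S \<noteq> {}"
    using uv by (auto simp: reachable_awalk)
  then have "Inf ?S \<in> ?S"
    by (rule Inf_nat_def1)
  then obtain p where p: "awalk u p v" "length p = gdist G u v"
    unfolding gdist_def by auto
  have "gdist G u v \<le> length q" if "awalk u q v" for q
    unfolding gdist_def by (rule wellorder_Inf_le1) (use that in auto)
  with p show ?thesis
    unfolding \<mu>_def awalk_cost_unit by (intro antisym INF_greatest INF_lower2[of p]) auto
qed

definition radius :: "'a pair_pre_digraph \<Rightarrow> nat" where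
  "radius G = Min ((\<lambda>v. Max (gdist G v ` pverts G)) ` pverts G)"

definition isometric_subgraph :: "'a pair_pre_digraph \<Rightarrow> 'a pair_pre_digraph \<Rightarrow> bool" where
  "isometric_subgraph H G \<longleftrightarrow> pair_graph H \<and> subgraph H G \<and>
     (\<forall>u \<in> pverts H. \<forall>v \<in> pverts H. gdist H u v = gdist G u v)"

text \<open>Intended for closed walks, whose vertices are exactly the tails of their arcs.\<close>

definition cycle_graph :: "('a \<times> 'a) awalk \<Rightarrow> 'a pair_pre_digraph" where
  "cycle_graph p = \<lparr>pverts = fst ` set p, parcs = set p \<union> (set p)\<inverse>\<rparr>"

text \<open>
  The condition \<open>3 \<le> length p\<close> is needed because \<open>pre_digraph.cycle\<close> also admits the closed walk
  \<open>[(u, v), (v, u)]\<close>, which runs along a single edge and back. The only bridgeless graph without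
  cycles has a single vertex; there the supremum is \<open>0\<close>.
\<close>

definition iso_length :: "'a pair_pre_digraph \<Rightarrow> nat" where
  "iso_length G = Sup {length p | p. pre_digraph.cycle G p \<and> 3 \<le> length p \<and>
                                     isometric_subgraph (cycle_graph p) G}"

definition rainbow_path :: "'a pair_pre_digraph \<Rightarrow> ('a set \<Rightarrow> nat) \<Rightarrow> 'a \<Rightarrow> ('a \<times> 'a) awalk \<Rightarrow> 'a \<Rightarrow> bool" where
  "rainbow_path G c u p v \<longleftrightarrow> pre_digraph.apath G u p v \<and> distinct (map (\<lambda>(x, y). c {x, y}) p)"

definition rainbow_colouring :: "'a pair_pre_digraph \<Rightarrow> ('a set \<Rightarrow> nat) \<Rightarrow> bool" where
  "rainbow_colouring G c \<longleftrightarrow> (\<forall>u \<in> pverts G. \<forall>v \<in> pverts G. \<exists>p. rainbow_path G c u p v)"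

definition rc :: "'a pair_pre_digraph \<Rightarrow> nat" where
  "rc G = (LEAST k. \<exists>c. rainbow_colouring G c \<and> card (c ` edges G) = k)"

end

theory Submission
  imports Defs
begin

text \<open>
  Upper bound: starting from a centre, a connected \<open>k\<close>-step dominating set \<open>D\<close> is enlarged to a
  \<open>(k - 1)\<close>-step dominating one at the cost of \<open>min (2 * k + 1) \<zeta>\<close> new colours. A breadth-first
  forest hangs one tree at every neighbour of \<open>D\<close>. By bridgelessness every tree has an edge
  leaving it, and the cheapest one closes a path (an ear) from \<open>D\<close> to \<open>D\<close> through the root of the
  tree. It has at most \<open>2 * k + 1\<close> edges since all depths are at most \<open>k\<close>, and at most \<open>\<zeta>\<close> edges
  since a shortest cycle through a given edge is isometric. If the trees are given two sides such
  that the chosen edges join different sides, all ears can be coloured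
  \<open>a\<^sub>1, a\<^sub>2, \<dots>, b\<^sub>2, b\<^sub>1\<close> consistently, and of any two ear vertices one can escape to \<open>D\<close> along an
  initial segment and the other along a final segment without repeating a colour.

  Lower bound: glue many copies of a chain of cycles of lengths \<open>min (2 * i + 1) \<zeta>\<close>, \<open>i = r, \<dots>, 1\<close>,
  at their first vertices. Two copies are coloured alike. A rainbow path between their ends uses,
  in every cycle, the short side in one copy and the long side in the other one, so that all edges
  of a copy have different colours.
\<close>


section \<open>Distances and connectivity\<close>

text \<open>Walks are handled as relational powers of the arc set, where concatenation, reversal and
  passing to fewer arcs are rules about relations.\<close>

lemma awalk_imp_relpow:
  assumes "pre_digraph.awalk (with_proj G) u p v"
  shows "(u, v) \<in> parcs G ^^ length p"
proof -
  have "set p \<subseteq> parcs G" "pcas u p v"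
    using assms by (auto simp: pre_digraph.awalk_def cas_with_proj_eq)
  then show ?thesis
    by (induction p arbitrary: u) (auto simp del: relpow.simps(2) intro: relpow_Suc_I2)
qed

lemma relpow_imp_awalk:
  assumes "pair_wf_digraph G" "u \<in> pverts G" "(u, v) \<in> parcs G ^^ n"
  shows "\<exists>p. pre_digraph.awalk (with_proj G) u p v \<and> length p = n"
proof -
  interpret pair_wf_digraph G by fact
  show ?thesis using assms(2,3)
  proof (induction n arbitrary: u)
    case 0
    then show ?case by (auto intro!: exI[of _ "[]"] simp: awalk_Nil_iff)
  next
    case (Suc n)
    obtain w where w: "(u, w) \<in> parcs G" "(w, v) \<in> parcs G ^^ n"
      using Suc.prems by (meson relpow_Suc_E2)
    obtain p where "awalk w p v" "length p = n"
      using Suc.IH[OF _ w(2)] w(1) in_arcsD2 by blast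
    then show ?case using w(1) Suc.prems(1)
      by (intro exI[of _ "(u, w) # p"]) (auto simp: awalk_Cons_iff)
  qed
qed

lemma gdist_le_awalk:
  "pre_digraph.awalk (with_proj G) u p v \<Longrightarrow> gdist G u v \<le> length p"
  unfolding gdist_def by (rule wellorder_Inf_le1) auto

lemma gdist_le:
  assumes "pair_wf_digraph G" "u \<in> pverts G" "(u, v) \<in> parcs G ^^ n"
  shows "gdist G u v \<le> n"
  using relpow_imp_awalk[OF assms] gdist_le_awalk by metis

lemma gdist_attained:
  assumes "pair_wf_digraph G" "u \<in> pverts G" "(u, v) \<in> (parcs G)\<^sup>*"
  shows "(u, v) \<in> parcs G ^^ gdist G u v"
proof -
  let ?S = "{length p |p. pre_digraph.awalk (with_proj G) u p v}"
  obtain n where "(u, v) \<in> parcs G ^^ n"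
    using assms(3) rtrancl_imp_relpow by blast
  then have "?S \<noteq> {}"
    using relpow_imp_awalk[OF assms(1,2)] by blast
  then have "gdist G u v \<in> ?S"
    unfolding gdist_def by (rule Inf_nat_def1)
  then show ?thesis
    using awalk_imp_relpow by fastforce
qed

lemma connected_iff_rtrancl:
  assumes "sym (parcs G)" "\<And>u v. (u, v) \<in> parcs G \<Longrightarrow> u \<in> pverts G \<and> v \<in> pverts G"
  shows "connected (with_proj G) \<longleftrightarrow>
    pverts G \<noteq> {} \<and> (\<forall>u \<in> pverts G. \<forall>v \<in> pverts G. (u, v) \<in> (parcs G)\<^sup>*)"
proof -
  have "(parcs G)\<^sup>s = parcs G"
    using assms(1) by (auto simp: symcl_def sym_def)
  moreover have "(u, v) \<in> rtrancl_on (pverts G) (parcs G) \<longleftrightarrow> (u, v) \<in> (parcs G)\<^sup>*"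
    if "u \<in> pverts G" for u v
  proof
    show "(u, v) \<in> rtrancl_on (pverts G) (parcs G)" if "(u, v) \<in> (parcs G)\<^sup>*"
      using that by induction (use \<open>u \<in> pverts G\<close> assms(2) in \<open>auto intro: rtrancl_on_into_rtrancl_on\<close>)
  qed (rule rtrancl_on_rtranclI)
  ultimately show ?thesis
    by (simp add: connected_conv)
qed

text \<open>A detour between the ends of the removed edge replaces every use of that edge, so these
  two vertices decide connectivity.\<close>

lemma connected_remove_edge_iff:
  assumes "pair_graph G" "(x, y) \<in> parcs G" "connected (with_proj G)"
  shows "connected (with_proj (remove_edge G x y)) \<longleftrightarrow> (x, y) \<in> (parcs G - {(x, y), (y, x)})\<^sup>*"
proof -
  interpret pair_graph G by fact
  let ?H = "remove_edge G x y" and ?A = "parcs G - {(x, y), (y, x)}"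
  have symA: "sym ?A" and wfA: "\<And>u v. (u, v) \<in> ?A \<Longrightarrow> u \<in> pverts G \<and> v \<in> pverts G"
    using in_arcsD1 in_arcsD2 by (auto simp: sym_def intro: arcs_symmetric)
  have xy: "x \<in> pverts G" "y \<in> pverts G"
    using assms(2) in_arcsD1 in_arcsD2 by blast+
  have symG: "sym (parcs G)" by (auto simp: sym_def intro: arcs_symmetric)
  have G: "\<And>u v. u \<in> pverts G \<Longrightarrow> v \<in> pverts G \<Longrightarrow> (u, v) \<in> (parcs G)\<^sup>*"
    using assms(3) connected_iff_rtrancl[OF symG] in_arcsD1 in_arcsD2 by blast
  have "connected (with_proj ?H) \<longleftrightarrow>
      pverts G \<noteq> {} \<and> (\<forall>u \<in> pverts G. \<forall>v \<in> pverts G. (u, v) \<in> ?A\<^sup>*)"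
    using connected_iff_rtrancl[of ?H] symA wfA by (auto simp: remove_edge_def)
  also have "\<dots> \<longleftrightarrow> (x, y) \<in> ?A\<^sup>*"
  proof (safe)
    assume *: "(x, y) \<in> ?A\<^sup>*"
    then have "(y, x) \<in> ?A\<^sup>*"
      using symA by (meson sym_rtrancl symD)
    with * have "parcs G \<subseteq> ?A\<^sup>*" by auto
    then have "(parcs G)\<^sup>* \<subseteq> ?A\<^sup>*"
      by (simp add: rtrancl_subset_rtrancl)
    then show "(u, v) \<in> ?A\<^sup>*" if "u \<in> pverts G" "v \<in> pverts G" for u v
      using G that by blast
  qed (use xy in auto)
  finally show ?thesis .
qed

lemma relpow_sym:
  assumes "sym A" "(x, y) \<in> A ^^ n"
  shows "(y, x) \<in> A ^^ n"
  using assms(2)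
proof (induction n arbitrary: y)
  case (Suc n)
  then show ?case
    using assms(1) by (auto simp: sym_def intro: relpow_Suc_I2 simp del: relpow.simps(2) elim!: relpow_Suc_E)
qed auto

lemma relpow_appendI: "(x, y) \<in> A ^^ m \<Longrightarrow> (y, z) \<in> A ^^ n \<Longrightarrow> (x, z) \<in> A ^^ (m + n)"
  by (auto simp: relpow_add)

lemma relpow_mono_rel:
  fixes A B :: "('a \<times> 'a) set"
  shows "(x, y) \<in> A ^^ n \<Longrightarrow> A \<subseteq> B \<Longrightarrow> (x, y) \<in> B ^^ n"
  by (induction n arbitrary: y) auto

lemma relpow_chain:
  assumes "\<And>i. i < n \<Longrightarrow> (f i, f (Suc i)) \<in> A"
  shows "(f 0, f n) \<in> A ^^ n"
  using assms by (induction n) auto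

lemma relpow_cyclic:
  assumes "0 < l" "\<And>i. i < l \<Longrightarrow> (w i, w (Suc i mod l)) \<in> A"
  shows "(w (a mod l), w ((a + n) mod l)) \<in> A ^^ n"
proof -
  have "(w ((a + i) mod l), w ((a + Suc i) mod l)) \<in> A" for i
    using assms(2)[of "(a + i) mod l"] assms(1) by (simp add: mod_Suc_eq)
  from relpow_chain[of n "\<lambda>i. w ((a + i) mod l)", OF this] show ?thesis by simp
qed

section \<open>Rainbow walks and evenly coloured ears\<close>

text \<open>\<open>S\<close> is the exact set of colours on the walk, so that walks with disjoint
  colour sets can be joined. The walk need not be a path; a path is extracted only at the
  end.\<close>

inductive rainbow_reach :: "('a \<times> 'a) set \<Rightarrow> ('a set \<Rightarrow> nat) \<Rightarrow> 'a \<Rightarrow> 'a \<Rightarrow> nat set \<Rightarrow> bool"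
  for A c where
  refl: "rainbow_reach A c u u {}"
| step: "(u, w) \<in> A \<Longrightarrow> rainbow_reach A c w v S \<Longrightarrow> c {u, w} \<notin> S \<Longrightarrow>
    rainbow_reach A c u v (insert (c {u, w}) S)"

lemma rainbow_reach_edge: "(u, w) \<in> A \<Longrightarrow> rainbow_reach A c u w {c {u, w}}"
  using rainbow_reach.step[OF _ rainbow_reach.refl] by fastforce

lemma rainbow_reach_trans:
  assumes "rainbow_reach A c u v S" "rainbow_reach A c v w T" "S \<inter> T = {}"
  shows "rainbow_reach A c u w (S \<union> T)"
  using assms
proof induction
  case (step u x v S)
  then show ?case
    using rainbow_reach.step[of u x A c w "S \<union> T"] by auto
qed auto

lemma rainbow_reach_sym:
  assumes "sym A" "rainbow_reach A c u v S"
  shows "rainbow_reach A c v u S"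
  using assms(2)
proof induction
  case (step u w v S)
  have "(w, u) \<in> A" using step.hyps(1) assms(1) by (auto simp: sym_def)
  from rainbow_reach_edge[OF this, of c] have "rainbow_reach A c w u {c {u, w}}"
    by (simp add: insert_commute)
  from rainbow_reach_trans[OF step.IH this] step.hyps(3) show ?case by simp
qed (rule rainbow_reach.refl)

lemma rainbow_reach_mono:
  assumes "rainbow_reach A c u v S" "A \<subseteq> B" "\<And>x y. (x, y) \<in> A \<Longrightarrow> c' {x, y} = c {x, y}"
  shows "rainbow_reach B c' u v S"
  using assms(1)
proof induction
  case (step u w v S)
  then show ?case
    using rainbow_reach.step[of u w B c' v S] assms(2,3) by auto
qed (rule rainbow_reach.refl)

lemma rainbow_reach_colours:
  "rainbow_reach A c u v S \<Longrightarrow> S \<subseteq> {c {x, y} |x y. (x, y) \<in> A}"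
  by (induction rule: rainbow_reach.induct) auto

text \<open>Cutting closed pieces out of a walk leaves a subset of its arcs, and the colouring is
  injective on the arcs of the walk.\<close>

lemma rainbow_reach_imp_rainbow_path:
  assumes G: "pair_wf_digraph G" and "u \<in> pverts G" "rainbow_reach (parcs G) c u v S"
  shows "\<exists>p. rainbow_path G c u p v"
proof -
  interpret pair_wf_digraph G by fact
  let ?col = "\<lambda>(x, y). c {x, y}"
  have "\<exists>p. awalk u p v \<and> distinct (map ?col p) \<and> ?col ` set p = S"
    using assms(3,2)
  proof induction
    case (refl u)
    then show ?case by (intro exI[of _ "[]"]) (auto simp: awalk_Nil_iff)
  next
    case (step u w v S)
    then obtain p where "awalk w p v" "distinct (map ?col p)" "?col ` set p = S"
      using in_arcsD2 by blast
    then show ?case using step.hyps step.prems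
      by (intro exI[of _ "(u, w) # p"]) (auto simp: awalk_Cons_iff)
  qed
  then obtain p where p: "awalk u p v" "distinct (map ?col p)" by blast
  let ?q = "awalk_to_apath p"
  have q: "apath u ?q v" "set ?q \<subseteq> set p"
    using p(1) by (auto intro: apath_awalk_to_apath dest: awalk_to_apath_subset)
  have "distinct ?q"
    using q(1) distinct_verts_imp_distinct by (auto simp: apath_def)
  moreover have "inj_on ?col (set ?q)"
    using p(2) q(2) by (auto simp: distinct_map intro: inj_on_subset)
  ultimately show ?thesis
    using q(1) unfolding rainbow_path_def by (auto simp: distinct_map)
qed

section \<open>Even and odd colours along an ear\<close>

text \<open>The first half of the ear gets 0, 2, 4, ... from its start and the second half 1, 3, 5,
  ... from its end. So ears of different lengths agree at equal distance from the same end, as long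
  as both edges lie in the corresponding half.\<close>

definition ear_colour :: "nat \<Rightarrow> nat \<Rightarrow> nat" where
  "ear_colour p i = (if 2 * i < p then 2 * i else 2 * p - 1 - 2 * i)"

text \<open>The shift by \<open>n\<close> separates ear colours from those used within
  \<open>D\<close>. An ear with \<open>p = 0\<close> is a single vertex of \<open>D\<close>.\<close>

definition even_ear ::
  "('a \<times> 'a) set \<Rightarrow> ('a set \<Rightarrow> nat) \<Rightarrow> nat \<Rightarrow> 'a set \<Rightarrow> nat \<Rightarrow> (nat \<Rightarrow> 'a) \<Rightarrow> bool" where
  "even_ear A c n D p X \<longleftrightarrow> X 0 \<in> D \<and> X p \<in> D \<and>
     (\<forall>i<p. (X i, X (Suc i)) \<in> A \<and> c {X i, X (Suc i)} = n + ear_colour p i)"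

text \<open>The parity of a colour tells the half. The index is then determined from the start or,
  as \<open>p + j = q + i\<close> says, from the end.\<close>

lemma ear_colour_eqD:
  assumes "i < p" "j < q" "ear_colour p i = ear_colour q j"
  shows "2 * i < p \<and> 2 * j < q \<and> i = j \<or> p \<le> 2 * i \<and> q \<le> 2 * j \<and> p + j = q + i"
proof -
  have odd: "odd (2 * p - 1 - 2 * i)" "odd (2 * q - 1 - 2 * j)"
    using assms(1,2) by auto
  have "2 * i \<noteq> 2 * q - 1 - 2 * j" "2 * p - 1 - 2 * i \<noteq> 2 * j"
    using odd by (metis dvd_triv_left)+
  then show ?thesis
    using assms unfolding ear_colour_def by (auto split: if_splits)
qed

lemma ear_colour_inj: "i < p \<Longrightarrow> j < p \<Longrightarrow> ear_colour p i = ear_colour p j \<Longrightarrow> i = j"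
  using ear_colour_eqD[of i p j p] by auto

lemma ear_colour_less: "i < p \<Longrightarrow> ear_colour p i < p"
  unfolding ear_colour_def by auto

text \<open>Colours shared by two ears occur in the same order on both. Clashes for both choices
  would give two shared colours in opposite orders, \<open>t < s\<close> and
  \<open>s' < t'\<close>.\<close>

lemma ear_colour_disjoint:
  assumes "i \<le> p" "j \<le> q"
  shows "ear_colour p ` {..<i} \<inter> ear_colour q ` {j..<q} = {} \<or>
    ear_colour p ` {i..<p} \<inter> ear_colour q ` {..<j} = {}"
proof (rule ccontr)
  assume no: "\<not> ?thesis"
  then obtain x where "x \<in> ear_colour p ` {..<i}" "x \<in> ear_colour q ` {j..<q}" by blast
  then obtain t t' where t: "t < i" "j \<le> t'" "t' < q" "ear_colour p t = ear_colour q t'" by force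
  from no obtain y where "y \<in> ear_colour p ` {i..<p}" "y \<in> ear_colour q ` {..<j}" by blast
  then obtain s s' where s: "i \<le> s" "s < p" "s' < j" "ear_colour p s = ear_colour q s'" by force
  have "t < p" "s' < q" using t s by auto
  from ear_colour_eqD[OF this(1) t(3,4)] ear_colour_eqD[OF s(2) this(2) s(4)] show False
    using t(1-3) s(1-3) by (elim disjE conjE; linarith)
qed

lemma even_ear_prefix:
  assumes "even_ear A c n D p X" "sym A" "i \<le> p"
  shows "rainbow_reach A c (X i) (X 0) ((\<lambda>t. n + ear_colour p t) ` {..<i})"
  using assms(3)
proof (induction i)
  case 0
  then show ?case using rainbow_reach.refl by simp
next
  case (Suc i)
  have "(X (Suc i), X i) \<in> A" and c: "c {X (Suc i), X i} = n + ear_colour p i"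
    using assms Suc.prems by (auto simp: even_ear_def sym_def insert_commute)
  moreover have "n + ear_colour p i \<notin> (\<lambda>t. n + ear_colour p t) ` {..<i}"
    using Suc.prems by (auto dest!: ear_colour_inj[rotated 2])
  moreover have "rainbow_reach A c (X i) (X 0) ((\<lambda>t. n + ear_colour p t) ` {..<i})"
    using Suc by simp
  ultimately have "rainbow_reach A c (X (Suc i)) (X 0)
      (insert (c {X (Suc i), X i}) ((\<lambda>t. n + ear_colour p t) ` {..<i}))"
    by (intro rainbow_reach.step) simp_all
  then show ?case by (simp only: c lessThan_Suc image_insert)
qed

lemma even_ear_suffix:
  assumes "even_ear A c n D p X" "i \<le> p"
  shows "rainbow_reach A c (X i) (X p) ((\<lambda>t. n + ear_colour p t) ` {i..<p})"
  using assms(2)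
proof (induction i rule: inc_induct)
  case base
  then show ?case using rainbow_reach.refl by simp
next
  case (step i)
  have "(X i, X (Suc i)) \<in> A" and c: "c {X i, X (Suc i)} = n + ear_colour p i"
    using assms step by (auto simp: even_ear_def)
  moreover have "n + ear_colour p i \<notin> (\<lambda>t. n + ear_colour p t) ` {Suc i..<p}"
    using step.hyps by (auto dest!: ear_colour_inj[rotated 2])
  ultimately have "rainbow_reach A c (X i) (X p)
      (insert (c {X i, X (Suc i)}) ((\<lambda>t. n + ear_colour p t) ` {Suc i..<p}))"
    using step.IH by (intro rainbow_reach.step) simp_all
  moreover have "{i..<p} = insert i {Suc i..<p}" using step.hyps by auto
  ultimately show ?case by (simp only: c image_insert)
qed

text \<open>One vertex escapes along a prefix and the other along a suffix of its ear, with disjoint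
  new colours; between their ends in \<open>D\<close> only colours below \<open>n\<close>
  occur.\<close>

lemma even_ears_rainbow:
  assumes "sym A"
    and base: "\<And>u v. u \<in> D \<Longrightarrow> v \<in> D \<Longrightarrow> \<exists>S \<subseteq> {..<n}. rainbow_reach A c u v S"
    and X: "even_ear A c n D p X" "i \<le> p" and Y: "even_ear A c n D q Y" "j \<le> q"
  shows "\<exists>S. rainbow_reach A c (X i) (Y j) S"
proof -
  have glue: "\<exists>S. rainbow_reach A c u v S"
    if "rainbow_reach A c u x ((\<lambda>t. n + ear_colour p t) ` P)" "x \<in> D"
      "rainbow_reach A c v y ((\<lambda>t. n + ear_colour q t) ` Q)" "y \<in> D"
      "ear_colour p ` P \<inter> ear_colour q ` Q = {}" for u v x y P Q
  proof -
    obtain S where S: "S \<subseteq> {..<n}" "rainbow_reach A c x y S"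
      using base \<open>x \<in> D\<close> \<open>y \<in> D\<close> by blast
    have uy: "rainbow_reach A c u y ((\<lambda>t. n + ear_colour p t) ` P \<union> S)"
      using S by (intro rainbow_reach_trans[OF that(1)]) auto
    have yv: "rainbow_reach A c y v ((\<lambda>t. n + ear_colour q t) ` Q)"
      using rainbow_reach_sym[OF assms(1) that(3)] .
    have "((\<lambda>t. n + ear_colour p t) ` P \<union> S) \<inter> (\<lambda>t. n + ear_colour q t) ` Q = {}"
    proof -
      have "False" if "ear_colour q b = ear_colour p a" "a \<in> P" "b \<in> Q" for a b
        using that \<open>ear_colour p ` P \<inter> ear_colour q ` Q = {}\<close> by blast
      then show ?thesis using S(1) by auto
    qed
    from rainbow_reach_trans[OF uy yv this] show ?thesis by (rule exI)
  qed
  have ends: "X 0 \<in> D" "X p \<in> D" "Y 0 \<in> D" "Y q \<in> D"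
    using X Y by (auto simp: even_ear_def)
  show ?thesis
    using ear_colour_disjoint[OF X(2) Y(2)]
      glue[OF even_ear_prefix[OF X(1) assms(1) X(2)] ends(1) even_ear_suffix[OF Y] ends(4)]
      glue[OF even_ear_suffix[OF X] ends(2) even_ear_prefix[OF Y(1) assms(1) Y(2)] ends(3)]
    by blast
qed

text \<open>Weights do not increase along \<open>\<phi>\<close> and equal weight forces a mutual
  pair, so \<open>\<phi>\<close> has no cycle longer than two. The sides are fixed in order of
  increasing weight.\<close>

lemma bicolouring:
  fixes \<phi> :: "'a \<Rightarrow> 'a option" and w :: "'a \<Rightarrow> nat"
  assumes "finite N"
    and "\<And>x y. x \<in> N \<Longrightarrow> \<phi> x = Some y \<Longrightarrow>
      y \<in> N \<and> y \<noteq> x \<and> (w y < w x \<or> w y = w x \<and> \<phi> y = Some x)"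
  shows "\<exists>s :: 'a \<Rightarrow> bool. \<forall>x \<in> N. \<forall>y. \<phi> x = Some y \<longrightarrow> s x \<noteq> s y"
proof -
  obtain idx :: "'a \<Rightarrow> nat" where idx: "inj_on idx N"
    using finite_imp_inj_to_nat_seg[OF assms(1)] by metis
  have "\<exists>s :: 'a \<Rightarrow> bool. \<forall>x \<in> N. \<forall>y. w x < m \<longrightarrow> \<phi> x = Some y \<longrightarrow> s x \<noteq> s y" for m
  proof (induction m)
    case (Suc m)
    then obtain s :: "'a \<Rightarrow> bool"
      where s: "\<And>x y. x \<in> N \<Longrightarrow> w x < m \<Longrightarrow> \<phi> x = Some y \<Longrightarrow> s x \<noteq> s y"
      by blast
    \<comment> \<open>A vertex of weight \<open>m\<close> goes opposite to a target of smaller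
      weight; a mutual pair of weight \<open>m\<close> is separated by the injective
      \<open>idx\<close>.\<close>
    define s' where "s' x = (if w x < m then s x
      else case \<phi> x of None \<Rightarrow> False | Some y \<Rightarrow> if w y < m then \<not> s y else idx x < idx y)" for x
    have "s' x \<noteq> s' y" if "x \<in> N" "w x < Suc m" and xy: "\<phi> x = Some y" for x y
    proof -
      note y = assms(2)[OF that(1) xy]
      show ?thesis
      proof (cases "w x < m")
        case True
        then show ?thesis using s[OF that(1) True xy] y by (auto simp: s'_def)
      next
        case False
        then have x: "w x = m" using that(2) by simp
        show ?thesis
        proof (cases "w y < m")
          case True
          then show ?thesis using x xy by (simp add: s'_def)
        next
          case False
          then have "w y = m" "\<phi> y = Some x" using x y by auto
          moreover have "idx x \<noteq> idx y" using y that(1) inj_onD[OF idx, of x y] by auto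
          ultimately show ?thesis using x xy by (auto simp: s'_def)
        qed
      qed
    qed
    then show ?case by blast
  qed auto
  then obtain s :: "'a \<Rightarrow> bool"
    where "\<forall>x \<in> N. \<forall>y. w x < Suc (Max (w ` N)) \<longrightarrow> \<phi> x = Some y \<longrightarrow> s x \<noteq> s y"
    by blast
  then show ?thesis
    using assms(1) by (metis Max_ge finite_imageI image_eqI less_Suc_eq_le)
qed

lemma edge_function:
  assumes "sym A" "\<And>u v. (u, v) \<in> A \<Longrightarrow> h u v = h v u"
  shows "\<exists>c. \<forall>(u, v) \<in> A. c {u, v} = h u v"
proof -
  define c where "c e = (SOME k. \<exists>u v. (u, v) \<in> A \<and> e = {u, v} \<and> k = h u v)" for e
  have "c {u, v} = h u v" if "(u, v) \<in> A" for u v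
    unfolding c_def by (rule some_equality) (use that assms(2) in \<open>auto simp: doubleton_eq_iff\<close>)
  then show ?thesis by blast
qed

section \<open>Breadth-first forests\<close>

text \<open>\<open>D\<close> is the part that earlier rounds have coloured; the forest below covers
  the rest of the graph.\<close>

locale dominated_graph =
  fixes V :: "'a set" and A :: "('a \<times> 'a) set" and D :: "'a set"
  assumes finite_V: "finite V" and A_sub: "A \<subseteq> V \<times> V" and sym_A: "sym A"
    and D_sub: "D \<subseteq> V" and reach_D: "x \<in> V \<Longrightarrow> \<exists>u \<in> D. (u, x) \<in> A\<^sup>*"
begin

definition depth :: "'a \<Rightarrow> nat" where
  "depth x = (LEAST m. \<exists>u \<in> D. (u, x) \<in> A ^^ m)"

lemma depth_le: "u \<in> D \<Longrightarrow> (u, x) \<in> A ^^ m \<Longrightarrow> depth x \<le> m"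
  unfolding depth_def by (rule Least_le) auto

lemma depth_attained: "x \<in> V \<Longrightarrow> \<exists>u \<in> D. (u, x) \<in> A ^^ depth x"
  unfolding depth_def by (rule LeastI_ex) (meson reach_D rtrancl_imp_relpow)

lemma depth_eq_0_iff: "x \<in> V \<Longrightarrow> depth x = 0 \<longleftrightarrow> x \<in> D"
  using depth_attained[of x] depth_le[of x x 0] by auto

lemma depth_step: "(x, y) \<in> A \<Longrightarrow> depth y \<le> Suc (depth x)"
proof -
  assume xy: "(x, y) \<in> A"
  then obtain u where "u \<in> D" "(u, x) \<in> A ^^ depth x"
    using depth_attained[of x] A_sub by auto
  with xy show ?thesis
    by (intro depth_le) (auto intro: relpow_Suc_I simp del: relpow.simps(2))
qed

lemma depth_step': "(x, y) \<in> A \<Longrightarrow> depth x \<le> Suc (depth y)"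
  using depth_step sym_A by (auto simp: sym_def)

definition parent :: "'a \<Rightarrow> 'a" where
  "parent x = (SOME w. (w, x) \<in> A \<and> Suc (depth w) = depth x)"

lemma parent:
  assumes "x \<in> V" "x \<notin> D"
  shows "(parent x, x) \<in> A" "Suc (depth (parent x)) = depth x"
proof -
  obtain u where u: "u \<in> D" "(u, x) \<in> A ^^ depth x" using depth_attained assms(1) by blast
  obtain m where m: "depth x = Suc m" using depth_eq_0_iff assms not0_implies_Suc by blast
  then obtain w where w: "(u, w) \<in> A ^^ m" "(w, x) \<in> A" using u(2) by auto
  then have "Suc (depth w) = depth x"
    using depth_le[OF u(1) w(1)] depth_step[OF w(2)] m by simp
  with w(2) have "\<exists>w. (w, x) \<in> A \<and> Suc (depth w) = depth x" by blast
  from someI_ex[OF this] show "(parent x, x) \<in> A" "Suc (depth (parent x)) = depth x"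
    unfolding parent_def by blast+
qed

lemma ancestor:
  assumes "x \<in> V" "k \<le> depth x"
  shows "(parent ^^ k) x \<in> V \<and> depth ((parent ^^ k) x) = depth x - k \<and>
    ((parent ^^ k) x, x) \<in> A ^^ k"
  using assms(2)
proof (induction k)
  case (Suc k)
  let ?y = "(parent ^^ k) x"
  have y: "?y \<in> V" "depth ?y = depth x - k" "(?y, x) \<in> A ^^ k" using Suc by auto
  then have "?y \<notin> D" using depth_eq_0_iff[of ?y] Suc.prems by auto
  from parent[OF y(1) this] y Suc.prems A_sub show ?case
    by (auto simp del: relpow.simps(2) intro: relpow_Suc_I2)
qed (use assms in auto)

text \<open>The ancestor at depth 1. By truncated subtraction a vertex of \<open>D\<close> is its
  own root.\<close>

definition root :: "'a \<Rightarrow> 'a" where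
  "root x = (parent ^^ (depth x - 1)) x"

lemma root_ancestor:
  assumes "x \<in> V" "k < depth x"
  shows "root ((parent ^^ k) x) = root x"
proof -
  have "depth ((parent ^^ k) x) = depth x - k"
    using ancestor assms by simp
  then have "root ((parent ^^ k) x) = (parent ^^ (depth x - k - 1 + k)) x"
    unfolding root_def funpow_add by simp
  then show ?thesis using assms(2) by (simp add: root_def)
qed

lemma depth_root: "x \<in> V \<Longrightarrow> x \<notin> D \<Longrightarrow> root x \<in> V \<and> depth (root x) = 1 \<and> root x \<notin> D"
  using ancestor[of x "depth x - 1"] depth_eq_0_iff[of x] depth_eq_0_iff[of "root x"]
  unfolding root_def by force

lemma root_depth_1: "depth x = 1 \<Longrightarrow> root x = x"
  by (simp add: root_def)

text \<open>The edge from the root to its parent is left out: an ear closed by it would run back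
  along the same edge.\<close>

definition leaving :: "'a \<Rightarrow> ('a \<times> 'a) set" where
  "leaving x = {(y, z) \<in> A. y \<notin> D \<and> root y = x \<and> (z \<in> D \<or> root z \<noteq> x) \<and> (y, z) \<noteq> (x, parent x)}"

text \<open>The reversed arc is not the one left out, since \<open>y\<close> is outside
  \<open>D\<close> while the parent of a root is inside.\<close>

lemma leaving_swap:
  assumes "(y, z) \<in> leaving x" "z \<notin> D"
  shows "(z, y) \<in> leaving (root z)"
proof -
  have z: "z \<in> V" "(z, y) \<in> A" using assms A_sub sym_A by (auto simp: leaving_def sym_def)
  have "root z \<in> V" "depth (root z) = 1" "root z \<notin> D"
    using depth_root z(1) assms(2) by auto
  then have "depth (parent (root z)) = 0" "parent (root z) \<in> V"
    using parent[of "root z"] A_sub by auto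
  then have "parent (root z) \<in> D" using depth_eq_0_iff by blast
  then show ?thesis using assms z by (auto simp: leaving_def)
qed

text \<open>Both ends of a forest edge lie in one tree, except where a root hangs on
  \<open>D\<close>. Hence \<open>step_colour\<close> treats a leaving edge as a cross edge.\<close>

lemma leaving_not_parent:
  assumes "(y, z) \<in> leaving x"
  shows "z \<noteq> parent y" "z \<notin> D \<Longrightarrow> y \<noteq> parent z"
proof -
  have y: "y \<in> V" "z \<in> V" "y \<notin> D" "root y = x" using assms A_sub by (auto simp: leaving_def)
  show "z \<noteq> parent y"
  proof
    assume z: "z = parent y"
    show False
    proof (cases "depth y = 1")
      case True
      then show ?thesis using root_depth_1 y z assms by (auto simp: leaving_def)
    next
      case False
      then have "1 < depth y" using y depth_eq_0_iff[of y] by linarith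
      moreover from this have "z \<notin> D" using parent[OF y(1,3)] z depth_eq_0_iff[OF y(2)] by auto
      ultimately show ?thesis using root_ancestor[OF y(1), of 1] y z assms by (auto simp: leaving_def)
    qed
  qed
  show "y \<noteq> parent z" if "z \<notin> D"
  proof
    assume yz: "y = parent z"
    have "depth y \<noteq> 0" using y depth_eq_0_iff by blast
    then have "1 < depth z" using parent(2)[OF y(2) that] unfolding yz[symmetric] by linarith
    then show False using root_ancestor[OF y(2), of 1] y yz that assms by (auto simp: leaving_def)
  qed
qed

text \<open>A detour around the tree edge above \<open>x\<close> has to leave the subtree below \<open>x\<close>.\<close>

lemma leaving_detour:
  assumes x: "x \<in> V" "depth x = 1"
    and q: "(x, parent x) \<in> (A - {(parent x, x), (x, parent x)}) ^^ q"
  shows "\<exists>(y, z) \<in> leaving x. depth y + depth z \<le> q"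
proof -
  let ?B = "A - {(parent x, x), (x, parent x)}"
  have xD: "x \<notin> D" using x depth_eq_0_iff[of x] by auto
  have px: "parent x \<in> V" using parent[OF x(1) xD] A_sub by auto
  have "depth (parent x) = 0" using parent[OF x(1) xD] x(2) by simp
  then have pxD: "parent x \<in> D" using depth_eq_0_iff[OF px] by simp
  \<comment> \<open>\<open>u\<close> is reached by \<open>i\<close> steps inside the tree, which
    bounds its depth. If the next step leaves the tree, its far end reaches \<open>D\<close> in the
    steps that remain.\<close>
  have "\<exists>(y, z) \<in> leaving x. depth y + depth z \<le> i + m"
    if "(u, parent x) \<in> ?B ^^ m" "u \<in> V" "u \<notin> D" "root u = x" "depth u \<le> Suc i" for u m i
    using that
  proof (induction m arbitrary: u i)
    case 0
    then show ?case using pxD by auto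
  next
    case (Suc m)
    obtain w where w: "(u, w) \<in> ?B" "(w, parent x) \<in> ?B ^^ m"
      using Suc.prems(1) by (meson relpow_Suc_E2)
    have wV: "w \<in> V" using w(1) A_sub by auto
    show ?case
    proof (cases "w \<notin> D \<and> root w = x")
      case True
      have "depth w \<le> Suc (Suc i)" using depth_step[of u w] w(1) Suc.prems(5) by auto
      from Suc.IH[OF w(2) wV _ _ this] True show ?thesis by auto
    next
      case False
      then have "(u, w) \<in> leaving x"
        using w(1) Suc.prems unfolding leaving_def by auto
      moreover have "depth w \<le> m"
      proof -
        have "(w, parent x) \<in> A ^^ m" using relpow_mono_rel[OF w(2)] by blast
        then show ?thesis using relpow_sym[OF sym_A] depth_le[OF pxD] by blast
      qed
      ultimately show ?thesis using Suc.prems(5) by force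
    qed
  qed
  from this[OF q x(1) xD root_depth_1[OF x(2)], of 0] x(2) show ?thesis by simp
qed

section \<open>Ears and the colours of their edges\<close>

text \<open>The path leads from \<open>D\<close> down the tree to \<open>a\<close>, takes the edge
  to \<open>b\<close> as step number \<open>depth a\<close>, counted from 0, and climbs from
  \<open>b\<close> back to \<open>D\<close>.\<close>

definition ear :: "'a \<Rightarrow> 'a \<Rightarrow> nat \<Rightarrow> 'a" where
  "ear a b i = (if i \<le> depth a then (parent ^^ (depth a - i)) a
     else (parent ^^ (i - depth a - 1)) b)"

definition ear_length :: "'a \<Rightarrow> 'a \<Rightarrow> nat" where
  "ear_length a b = depth a + depth b + 1"

text \<open>Trees on side \<open>False\<close> get even colours, as on the first half of an ear, and
  trees on side \<open>True\<close> odd ones.\<close>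

definition side_colour :: "('a \<Rightarrow> bool) \<Rightarrow> 'a \<Rightarrow> nat" where
  "side_colour s x = (if s (root x) then 1 else 0)"

text \<open>A vertex of \<open>D\<close> belongs to both sides, so at a cross edge the side of the deeper end decides.\<close>

definition step_colour :: "('a \<Rightarrow> bool) \<Rightarrow> 'a \<Rightarrow> 'a \<Rightarrow> nat" where
  "step_colour s u v =
    (if v \<notin> D \<and> u = parent v then 2 * (depth v - 1) + side_colour s v
     else if u \<notin> D \<and> v = parent u then 2 * (depth u - 1) + side_colour s u
     else if depth u < depth v then 2 * depth u + 1 - side_colour s v
     else if depth v < depth u then 2 * depth v + 1 - side_colour s u
     else 2 * depth u)"

lemma step_colour_commute:
  assumes "u \<in> V" "v \<in> V"
  shows "step_colour s u v = step_colour s v u"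
proof -
  have "\<not> (v \<notin> D \<and> u = parent v \<and> u \<notin> D \<and> v = parent u)"
    using parent(2)[OF assms(1)] parent(2)[OF assms(2)] by auto
  then show ?thesis unfolding step_colour_def by auto
qed

text \<open>\<open>step_colour\<close> depends on the edge and the sides but not on the ear, so ears
  that share edges agree. The depths of \<open>a\<close> and \<open>b\<close> differ by at most one,
  hence the two tree paths lie in different halves of the ear.\<close>

lemma ear_edges:
  assumes ab: "(a, b) \<in> A" "\<not> (a \<in> D \<and> b \<in> D)"
    and np: "b \<notin> D \<Longrightarrow> a \<noteq> parent b" "a \<notin> D \<Longrightarrow> b \<noteq> parent a"
    and sides: "a \<in> D \<or> \<not> s (root a)" "b \<in> D \<or> s (root b)"
    and i: "i < ear_length a b"
  shows "(ear a b i, ear a b (Suc i)) \<in> A \<and> \<not> (ear a b i \<in> D \<and> ear a b (Suc i) \<in> D) \<and>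
    step_colour s (ear a b i) (ear a b (Suc i)) = ear_colour (ear_length a b) i"
proof -
  have V: "a \<in> V" "b \<in> V" using ab A_sub by auto
  have close: "depth a \<le> Suc (depth b)" "depth b \<le> Suc (depth a)"
    using depth_step depth_step' ab(1) by auto
  consider "i < depth a" | "i = depth a" | "depth a < i" by linarith
  then show ?thesis
  proof cases
    case 1
    let ?v = "(parent ^^ (depth a - Suc i)) a"
    have v: "?v \<in> V" "depth ?v = Suc i" using ancestor[OF V(1), of "depth a - Suc i"] 1 by auto
    then have vD: "?v \<notin> D" using depth_eq_0_iff[of ?v] by auto
    have r: "root ?v = root a" using root_ancestor[OF V(1)] 1 by simp
    have "a \<notin> D" using depth_eq_0_iff[of a] V 1 by auto
    then have s: "side_colour s ?v = 0" using sides r by (simp add: side_colour_def)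
    have "depth a - i = Suc (depth a - Suc i)" using 1 by simp
    then have X: "ear a b i = parent ?v" "ear a b (Suc i) = ?v"
      using 1 by (simp_all add: ear_def)
    show ?thesis
      unfolding X using parent[OF v(1) vD] vD v s 1 close
      by (simp add: step_colour_def ear_colour_def ear_length_def)
  next
    case 2
    have X: "ear a b i = a" "ear a b (Suc i) = b" using 2 by (simp_all add: ear_def)
    have "side_colour s b = 1" if "depth a < depth b"
      using that depth_eq_0_iff[OF V(2)] sides by (auto simp: side_colour_def)
    moreover have "side_colour s a = 0" if "depth b < depth a"
      using that depth_eq_0_iff[OF V(1)] sides by (auto simp: side_colour_def)
    ultimately show ?thesis
      unfolding X using close ab np 2 by (auto simp: step_colour_def ear_colour_def ear_length_def)
  next
    case 3
    let ?v = "(parent ^^ (i - depth a - 1)) b"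
    have k: "i - depth a - 1 < depth b" using 3 i by (auto simp: ear_length_def)
    have v: "?v \<in> V" "depth ?v = ear_length a b - i"
      using ancestor[OF V(2), of "i - depth a - 1"] k 3 by (auto simp: ear_length_def)
    then have vD: "?v \<notin> D" using depth_eq_0_iff[of ?v] i by auto
    have r: "root ?v = root b" using root_ancestor[OF V(2) k] .
    have "b \<notin> D" using depth_eq_0_iff[of b] V k by auto
    then have s: "side_colour s ?v = 1" using sides r by (simp add: side_colour_def)
    have "Suc i - depth a - 1 = Suc (i - depth a - 1)" using 3 by simp
    then have X: "ear a b i = ?v" "ear a b (Suc i) = parent ?v"
      using 3 by (simp_all add: ear_def)
    have c: "step_colour s ?v (parent ?v) = 2 * (ear_length a b - i - 1) + 1"
      using step_colour_commute[OF v(1), of "parent ?v" s] parent[OF v(1) vD] vD v s A_sub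
      by (auto simp: step_colour_def)
    have e: "ear_colour (ear_length a b) i = 2 * (ear_length a b - i - 1) + 1"
      using close 3 i by (auto simp: ear_colour_def ear_length_def)
    show ?thesis
      unfolding X c e using parent[OF v(1) vD] vD sym_A by (auto simp: sym_def)
  qed
qed

lemma ear_ends:
  assumes "a \<in> V" "b \<in> V"
  shows "ear a b 0 \<in> D" "ear a b (ear_length a b) \<in> D"
proof -
  have "depth ((parent ^^ depth x) x) = 0" "(parent ^^ depth x) x \<in> V" if "x \<in> V" for x
    using ancestor[OF that, of "depth x"] by auto
  then have "(parent ^^ depth x) x \<in> D" if "x \<in> V" for x
    using that depth_eq_0_iff by blast
  then show "ear a b 0 \<in> D" "ear a b (ear_length a b) \<in> D"
    using assms by (simp_all add: ear_def ear_length_def)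
qed

lemma ear_in_V:
  assumes "a \<in> V" "b \<in> V" "i \<le> ear_length a b"
  shows "ear a b i \<in> V"
  using ancestor[of a "depth a - i"] ancestor[of b "i - depth a - 1"] assms
  by (auto simp: ear_def ear_length_def)

lemma root_on_ear:
  assumes "x \<in> V" "x \<notin> D"
  shows "\<exists>i \<le> ear_length x b. ear x b i = root x" "\<exists>i \<le> ear_length a x. ear a x i = root x"
proof -
  have d: "1 \<le> depth x" using assms depth_eq_0_iff[of x] by linarith
  show "\<exists>i \<le> ear_length x b. ear x b i = root x"
    using d by (intro exI[of _ 1]) (simp add: ear_def ear_length_def root_def)
  show "\<exists>i \<le> ear_length a x. ear a x i = root x"
    using d by (intro exI[of _ "depth a + depth x"]) (simp add: ear_def ear_length_def root_def)
qed

text \<open>Every tree picks its cheapest leaving edge. As in Boruvka's algorithm, breaking ties by an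
  injective weight makes the picked edges acyclic, so the trees can be given two sides such that
  every picked edge joins different sides.\<close>

lemma two_sided_ears:
  assumes cheap: "\<And>x. x \<in> V \<Longrightarrow> depth x = 1 \<Longrightarrow>
      \<exists>(y, z) \<in> leaving x. depth y + depth z < L"
  shows "\<exists>s. \<forall>x \<in> V. depth x = 1 \<longrightarrow> (\<exists>a b. (a, b) \<in> A \<and> \<not> (a \<in> D \<and> b \<in> D) \<and>
    (b \<notin> D \<longrightarrow> a \<noteq> parent b) \<and> (a \<notin> D \<longrightarrow> b \<noteq> parent a) \<and>
    (a \<in> D \<or> \<not> s (root a)) \<and> (b \<in> D \<or> s (root b)) \<and>
    ear_length a b \<le> L \<and> (\<exists>i \<le> ear_length a b. ear a b i = x))"
proof -
  define N where "N = {x \<in> V. depth x = 1}"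
  have "finite (Pow V)" using finite_V by simp
  then obtain idx :: "'a set \<Rightarrow> nat" and K where idx: "idx ` Pow V = {i. i < K}" "inj_on idx (Pow V)"
    using finite_imp_inj_to_nat_seg by metis
  \<comment> \<open>Cost first, index second, packed as quotient and remainder by \<open>K\<close>.
    The index belongs to the undirected edge, so both directions weigh the same.\<close>
  define W where "W e = (depth (fst e) + depth (snd e)) * K + idx {fst e, snd e}" for e
  have idx_less: "idx {fst e, snd e} < K" if "e \<in> A" for e
    using idx(1) that A_sub by (metis (no_types, lifting) Pow_iff SigmaE empty_subsetI fst_conv
        imageI insert_subset mem_Collect_eq snd_conv subsetD)
  have W_div: "W e div K = depth (fst e) + depth (snd e)" and W_mod: "W e mod K = idx {fst e, snd e}"
    if "e \<in> A" for e
    using idx_less[OF that] by (simp_all add: W_def)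
  have W_inj: "{fst e, snd e} = {fst e', snd e'}" if "e \<in> A" "e' \<in> A" "W e = W e'" for e e'
  proof -
    have "{fst e, snd e} \<in> Pow V" "{fst e', snd e'} \<in> Pow V" using that A_sub by auto
    then show ?thesis using that W_mod inj_onD[OF idx(2)] by metis
  qed
  define ch where "ch x = arg_min W (\<lambda>e. e \<in> leaving x)" for x
  have leaving_A: "leaving x \<subseteq> A" for x by (auto simp: leaving_def)
  have ch: "ch x \<in> leaving x" if x: "x \<in> N" for x
  proof -
    obtain e where "e \<in> leaving x" using cheap[of x] x unfolding N_def by blast
    then show ?thesis unfolding ch_def by (rule arg_min_natI)
  qed
  have ch_le: "W (ch x) \<le> W e" if "e \<in> leaving x" for x e
    unfolding ch_def using that by (rule arg_min_nat_le)
  have ch_cheap: "depth (fst (ch x)) + depth (snd (ch x)) < L" if x: "x \<in> N" for x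
  proof -
    obtain y z where yz: "(y, z) \<in> leaving x" "depth y + depth z < L"
      using cheap[of x] x unfolding N_def by blast
    have "W (ch x) div K \<le> W (y, z) div K"
      using ch_le[OF yz(1)] by (rule div_le_mono)
    then show ?thesis
      using W_div[of "ch x"] W_div[of "(y, z)"] yz subsetD[OF leaving_A ch[OF x]]
        subsetD[OF leaving_A yz(1)] by simp
  qed
  define \<phi> where "\<phi> x = (if snd (ch x) \<in> D then None else Some (root (snd (ch x))))" for x
  have "\<exists>s :: 'a \<Rightarrow> bool. \<forall>x \<in> N. \<forall>y. \<phi> x = Some y \<longrightarrow> s x \<noteq> s y"
  proof (rule bicolouring[where w = "\<lambda>x. W (ch x)"])
    show "finite N" using finite_V by (simp add: N_def)
    fix x y assume x: "x \<in> N" and xy: "\<phi> x = Some y"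
    obtain f z where fz: "ch x = (f, z)" by (cases "ch x")
    have z: "z \<notin> D" "y = root z" using xy fz by (auto simp: \<phi>_def split: if_splits)
    have l: "(f, z) \<in> leaving x" using ch[OF x] fz by simp
    then have f: "f \<notin> D" "root f = x" "(f, z) \<in> A" "x \<noteq> y" "z \<in> V" "(z, f) \<in> A"
      using z A_sub sym_A by (auto simp: leaving_def sym_def)
    have y: "y \<in> N" using depth_root[OF f(5) z(1)] z(2) by (simp add: N_def)
    have l': "(z, f) \<in> leaving y" using leaving_swap[OF l z(1)] z(2) by simp
    have W_swap: "W (z, f) = W (ch x)" unfolding fz W_def by (simp add: insert_commute add.commute)
    \<comment> \<open>The edge chosen at \<open>x\<close> is also available at \<open>y\<close>, so
      the choice there is no heavier. In case of equality both trees chose the same edge.\<close>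
    have le: "W (ch y) \<le> W (ch x)" using ch_le[OF l'] W_swap by simp
    have "\<phi> y = Some x" if "W (ch y) = W (ch x)"
    proof -
      have "ch y \<in> A" using ch[OF y] leaving_A by blast
      from W_inj[OF this f(6)] that W_swap have "{fst (ch y), snd (ch y)} = {z, f}" by simp
      moreover have "root (fst (ch y)) = y" using ch[OF y] by (auto simp: leaving_def)
      ultimately have "snd (ch y) = f" using f by (auto simp: doubleton_eq_iff)
      then show ?thesis using f by (simp add: \<phi>_def)
    qed
    then show "y \<in> N \<and> y \<noteq> x \<and>
        (W (ch y) < W (ch x) \<or> W (ch y) = W (ch x) \<and> \<phi> y = Some x)"
      using y f(4) le by auto
  qed
  then obtain s :: "'a \<Rightarrow> bool" where s: "\<And>x y. x \<in> N \<Longrightarrow> \<phi> x = Some y \<Longrightarrow> s x \<noteq> s y"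
    by blast
  show ?thesis
  proof (intro exI[of _ s] ballI impI)
    fix x assume "x \<in> V" "depth x = 1"
    then have x: "x \<in> N" by (simp add: N_def)
    obtain y z where yz: "ch x = (y, z)" by (cases "ch x")
    have l: "(y, z) \<in> leaving x" using ch[OF x] yz by simp
    then have y: "y \<notin> D" "root y = x" "(y, z) \<in> A" "(z, y) \<in> A" "y \<in> V"
      using sym_A A_sub by (auto simp: leaving_def sym_def)
    have z: "z \<in> D \<or> s (root z) \<noteq> s x"
      using s[OF x] yz by (auto simp: \<phi>_def)
    have len: "ear_length y z \<le> L" "ear_length z y \<le> L"
      using ch_cheap[OF x] yz by (auto simp: ear_length_def)
    note np = leaving_not_parent[OF l]
    show "\<exists>a b. (a, b) \<in> A \<and> \<not> (a \<in> D \<and> b \<in> D) \<and>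
      (b \<notin> D \<longrightarrow> a \<noteq> parent b) \<and> (a \<notin> D \<longrightarrow> b \<noteq> parent a) \<and>
      (a \<in> D \<or> \<not> s (root a)) \<and> (b \<in> D \<or> s (root b)) \<and>
      ear_length a b \<le> L \<and> (\<exists>i \<le> ear_length a b. ear a b i = x)"
    \<comment> \<open>A tree on side \<open>False\<close> has to come at the start of the ear and a
      tree on side \<open>True\<close> at its end.\<close>
    proof (cases "s x")
      case True
      then show ?thesis
        using y z len np root_on_ear(2)[OF y(5,1), of z] by (intro exI[of _ z] exI[of _ y]) auto
    next
      case False
      then show ?thesis
        using y z len np root_on_ear(1)[OF y(5,1), of z] by (intro exI[of _ y] exI[of _ z]) auto
    qed
  qed
qed

section \<open>One round of the enlargement\<close>

text \<open>All ears are added to \<open>D\<close>. Every root then lies in the new set, so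
  distances to it are one smaller. The bound \<open>2 * k + 3\<close> is
  \<open>2 * (k + 1) + 1\<close>, for depths up to \<open>k + 1\<close>; \<open>q < z\<close> says
  that the detour and its edge close a cycle of at most \<open>z\<close> edges.\<close>

lemma extend_rainbow:
  assumes depth_le: "\<And>x. x \<in> V \<Longrightarrow> depth x \<le> Suc k"
    and detour: "\<And>x y. (x, y) \<in> A \<Longrightarrow> \<exists>q. (y, x) \<in> (A - {(x, y), (y, x)}) ^^ q \<and> q < z"
    and base: "\<And>u v. u \<in> D \<Longrightarrow> v \<in> D \<Longrightarrow> \<exists>S. rainbow_reach (A \<inter> D \<times> D) c u v S"
    and c: "\<And>u v. (u, v) \<in> A \<Longrightarrow> u \<in> D \<Longrightarrow> v \<in> D \<Longrightarrow> c {u, v} < n"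
  shows "\<exists>D' c'. D \<subseteq> D' \<and> D' \<subseteq> V \<and> (\<forall>x \<in> V. \<exists>u \<in> D'. \<exists>m \<le> k. (u, x) \<in> A ^^ m) \<and>
    (\<forall>u v. u \<in> D' \<longrightarrow> v \<in> D' \<longrightarrow> (\<exists>S. rainbow_reach (A \<inter> D' \<times> D') c' u v S)) \<and>
    (\<forall>u v. (u, v) \<in> A \<longrightarrow> u \<in> D' \<longrightarrow> v \<in> D' \<longrightarrow> c' {u, v} < n + min (2 * k + 3) z)"
proof -
  define L where "L = min (2 * k + 3) z"
  have "\<exists>(y, w) \<in> leaving x. depth y + depth w < L" if x: "x \<in> V" "depth x = 1" for x
  proof -
    have "x \<notin> D" using x depth_eq_0_iff[of x] by auto
    then have "(parent x, x) \<in> A" using parent x(1) by blast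
    then obtain q where q: "(x, parent x) \<in> (A - {(parent x, x), (x, parent x)}) ^^ q" "q < z"
      using detour by blast
    obtain y w where yw: "(y, w) \<in> leaving x" "depth y + depth w \<le> q"
      using leaving_detour[OF x q(1)] by blast
    then have "y \<in> V" "w \<in> V" using A_sub by (auto simp: leaving_def)
    from depth_le[OF this(1)] depth_le[OF this(2)] yw q(2) show ?thesis
      by (auto simp: L_def intro!: bexI[of _ "(y, w)"])
  qed
  from two_sided_ears[OF this] obtain s where "\<forall>x \<in> V. depth x = 1 \<longrightarrow> (\<exists>a b. (a, b) \<in> A \<and>
    \<not> (a \<in> D \<and> b \<in> D) \<and> (b \<notin> D \<longrightarrow> a \<noteq> parent b) \<and> (a \<notin> D \<longrightarrow> b \<noteq> parent a) \<and>
    (a \<in> D \<or> \<not> s (root a)) \<and> (b \<in> D \<or> s (root b)) \<and>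
    ear_length a b \<le> L \<and> (\<exists>i \<le> ear_length a b. ear a b i = x))" by blast
  then obtain a b where ab: "\<And>x. x \<in> V \<Longrightarrow> depth x = 1 \<Longrightarrow> (a x, b x) \<in> A \<and>
    \<not> (a x \<in> D \<and> b x \<in> D) \<and> (b x \<notin> D \<longrightarrow> a x \<noteq> parent (b x)) \<and> (a x \<notin> D \<longrightarrow> b x \<noteq> parent (a x)) \<and>
    (a x \<in> D \<or> \<not> s (root (a x))) \<and> (b x \<in> D \<or> s (root (b x))) \<and>
    ear_length (a x) (b x) \<le> L \<and> (\<exists>i \<le> ear_length (a x) (b x). ear (a x) (b x) i = x)"
    by metis
  define N where "N = {x \<in> V. depth x = 1}"
  define X where "X x = ear (a x) (b x)" for x
  define len where "len x = ear_length (a x) (b x)" for x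
  \<comment> \<open>Edges off the ears may have a \<open>step_colour\<close> of \<open>L\<close> or
    more. They get colour \<open>n\<close>, so that at most \<open>L\<close> new colours are
    spent.\<close>
  define h where "h u v = (if u \<in> D \<and> v \<in> D then c {u, v}
    else n + (if step_colour s u v < L then step_colour s u v else 0))" for u v
  have h_commute: "h u v = h v u" if "(u, v) \<in> A" for u v
    using that step_colour_commute[of u v s] A_sub by (auto simp: h_def insert_commute)
  obtain c' where c': "\<And>u v. (u, v) \<in> A \<Longrightarrow> c' {u, v} = h u v"
    using edge_function[of A h, OF sym_A h_commute] by blast
  define D' where "D' = D \<union> (\<Union>x \<in> N. X x ` {..len x})"
  let ?B = "A \<inter> D' \<times> D'"
  have X_edge: "(X x i, X x (Suc i)) \<in> ?B \<and> c' {X x i, X x (Suc i)} = n + ear_colour (len x) i"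
    if "x \<in> N" "i < len x" for x i
  proof -
    have "x \<in> V" "depth x = 1" using that(1) by (simp_all add: N_def)
    note ab = ab[OF this]
    have e: "(X x i, X x (Suc i)) \<in> A" "\<not> (X x i \<in> D \<and> X x (Suc i) \<in> D)"
        "step_colour s (X x i) (X x (Suc i)) = ear_colour (len x) i"
      using ear_edges[of "a x" "b x" s i] ab that(2) unfolding X_def len_def by blast+
    have "ear_colour (len x) i < L"
      using ear_colour_less[OF that(2)] ab unfolding len_def by linarith
    moreover have "X x j \<in> D'" if "j \<le> len x" for j
      using that \<open>x \<in> N\<close> by (auto simp: D'_def)
    ultimately show ?thesis
      using e c'[OF e(1)] that by (auto simp: h_def)
  qed
  have ear_x: "even_ear ?B c' n D (len x) (X x)" if "x \<in> N" for x
  proof -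
    have "a x \<in> V" "b x \<in> V" using ab[of x] that A_sub by (auto simp: N_def)
    from ear_ends[OF this] X_edge[OF that] show ?thesis
      by (simp add: even_ear_def X_def len_def)
  qed
  \<comment> \<open>Vertices of \<open>D\<close> count as ears without edges, so one argument covers
    all pairs.\<close>
  have on_ear: "\<exists>p Y i. even_ear ?B c' n D p Y \<and> i \<le> p \<and> Y i = u" if "u \<in> D'" for u
  proof (cases "u \<in> D")
    case True
    then show ?thesis by (intro exI[of _ 0] exI[of _ "\<lambda>_. u"]) (simp add: even_ear_def)
  next
    case False
    then show ?thesis using that ear_x by (auto simp: D'_def)
  qed
  have symB: "sym ?B" using sym_A by (auto simp: sym_def)
  have baseB: "\<exists>S \<subseteq> {..<n}. rainbow_reach ?B c' u v S" if uv: "u \<in> D" "v \<in> D" for u v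
  proof -
    obtain S where S: "rainbow_reach (A \<inter> D \<times> D) c u v S" using base uv by blast
    have "S \<subseteq> {..<n}" using rainbow_reach_colours[OF S] c by auto
    moreover have "rainbow_reach ?B c' u v S"
      using S by (rule rainbow_reach_mono) (auto simp: D'_def c' h_def)
    ultimately show ?thesis by blast
  qed
  have "\<exists>S. rainbow_reach ?B c' u v S" if uv: "u \<in> D'" "v \<in> D'" for u v
  proof -
    obtain p Y i where Y: "even_ear ?B c' n D p Y" "i \<le> p" "Y i = u" using on_ear uv by blast
    obtain q Z j where Z: "even_ear ?B c' n D q Z" "j \<le> q" "Z j = v" using on_ear uv by blast
    show ?thesis using even_ears_rainbow[OF symB baseB Y(1,2) Z(1,2)] Y(3) Z(3) by simp
  qed
  moreover have "X x i \<in> V" if "x \<in> N" "i \<le> len x" for x i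
    using ear_in_V[of "a x" "b x" i] ab[of x] that A_sub by (auto simp: N_def X_def len_def)
  then have "D' \<subseteq> V" using D_sub by (auto simp: D'_def)
  moreover have "\<exists>u \<in> D'. \<exists>m \<le> k. (u, x) \<in> A ^^ m" if "x \<in> V" for x
  proof (cases "x \<in> D")
    case True
    then show ?thesis by (intro bexI[of _ x] exI[of _ 0]) (auto simp: D'_def)
  next
    case False
    have rN: "root x \<in> N" using depth_root[OF that False] by (simp add: N_def)
    have "\<exists>i \<le> len (root x). X (root x) i = root x"
      using ab[of "root x"] depth_root[OF that False] by (simp add: X_def len_def)
    then obtain i where i: "i \<le> len (root x)" "X (root x) i = root x" by blast
    have "X (root x) i \<in> D'" using rN i(1) by (auto simp: D'_def)
    then have "root x \<in> D'" using i(2) by simp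
    moreover have "(root x, x) \<in> A ^^ (depth x - 1)"
      using ancestor[OF that, of "depth x - 1"] by (simp add: root_def)
    moreover have "depth x - 1 \<le> k" using depth_le[OF that] by simp
    ultimately show ?thesis by blast
  qed
  moreover have "c' {u, v} < n + L" if uv: "(u, v) \<in> A" for u v
  proof -
    have "0 < L" using detour[OF uv] by (auto simp: L_def)
    then show ?thesis using c'[OF uv] c[OF uv] by (auto simp: h_def)
  qed
  ultimately show ?thesis
    unfolding L_def by (intro exI[of _ D'] exI[of _ c']) (auto simp: D'_def)
qed

end

section \<open>Isometric cycles and the upper bound\<close>

lemma gdist_commute:
  assumes "pair_graph G" "u \<in> pverts G" "v \<in> pverts G" "(u, v) \<in> (parcs G)\<^sup>*"
  shows "gdist G u v = gdist G v u"
proof -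
  interpret pair_graph G by fact
  have s: "sym (parcs G)" by (auto simp: sym_def intro: arcs_symmetric)
  then have vu: "(v, u) \<in> (parcs G)\<^sup>*" using assms(4) by (meson sym_rtrancl symD)
  have wf: "pair_wf_digraph G" ..
  show ?thesis
    using gdist_le[OF wf assms(3) relpow_sym[OF s gdist_attained[OF wf assms(2,4)]]]
      gdist_le[OF wf assms(2) relpow_sym[OF s gdist_attained[OF wf assms(3) vu]]]
    by simp
qed

definition cyclic_walk :: "(nat \<Rightarrow> 'a) \<Rightarrow> nat \<Rightarrow> ('a \<times> 'a) list" where
  "cyclic_walk w l = map (\<lambda>i. (w i, w (Suc i mod l))) [0..<l]"

lemma length_cyclic_walk [simp]: "length (cyclic_walk w l) = l"
  by (simp add: cyclic_walk_def)

lemma set_cyclic_walk: "set (cyclic_walk w l) = {(w i, w (Suc i mod l)) |i. i < l}"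
  by (auto simp: cyclic_walk_def)

lemma cycle_cyclic_walk:
  assumes "pair_wf_digraph G" "0 < l" "inj_on w {..<l}"
    and arcs: "\<And>i. i < l \<Longrightarrow> (w i, w (Suc i mod l)) \<in> parcs G"
  shows "pre_digraph.cycle (with_proj G) (cyclic_walk w l)"
proof -
  interpret pair_wf_digraph G by fact
  let ?p = "cyclic_walk w l"
  have awalk: "awalk (w 0) (map (\<lambda>i. (w i, w (Suc i mod l))) [0..<k]) (w (k mod l))" if "k \<le> l" for k
    using that
  proof (induction k)
    case 0
    then show ?case using arcs[of 0] assms(2) in_arcsD1 by (auto simp: awalk_Nil_iff)
  next
    case (Suc k)
    then have "awalk (w 0) (map (\<lambda>i. (w i, w (Suc i mod l))) [0..<k]) (w k)" by simp
    moreover have "awalk (w k) [(w k, w (Suc k mod l))] (w (Suc k mod l))"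
      using arcs[of k] Suc.prems in_arcsD1 in_arcsD2 by (auto simp: awalk_Cons_iff awalk_Nil_iff)
    ultimately show ?case using awalk_appendI by fastforce
  qed
  from awalk[of l] have p: "awalk (w 0) ?p (w 0)"
    unfolding cyclic_walk_def by simp
  have ne: "?p \<noteq> []" using assms(2) by (simp add: cyclic_walk_def)
  have "tl (awalk_verts (w 0) ?p) = map snd ?p"
    using awalk_verts_conv'[of "w 0" ?p "w 0"] p ne by auto
  also have "\<dots> = map w (map (\<lambda>i. Suc i mod l) [0..<l])"
    by (simp add: cyclic_walk_def)
  also have "distinct \<dots>"
  proof -
    have "inj_on (\<lambda>i. Suc i mod l) {0..<l}"
    proof (rule inj_onI)
      fix i j assume "i \<in> {0..<l}" "j \<in> {0..<l}" "Suc i mod l = Suc j mod l"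
      then show "i = j" by (simp add: mod_Suc split: if_splits)
    qed
    moreover have "(\<lambda>i. Suc i mod l) ` {0..<l} \<subseteq> {..<l}" using assms(2) by auto
    ultimately have "inj_on (w \<circ> (\<lambda>i. Suc i mod l)) {0..<l}"
      using assms(3) by (meson comp_inj_on inj_on_subset)
    then show ?thesis by (simp add: distinct_map)
  qed
  finally show ?thesis using p ne unfolding cycle_def by blast
qed

text \<open>Distances cannot be smaller in the cycle, as it is a subgraph. \<open>far\<close> gives
  the other inequality: no walk is shorter than both ways along the cycle.\<close>

lemma isometric_cyclic_walk:
  assumes G: "pair_graph G" and l: "2 \<le> l" "inj_on w {..<l}"
    and arcs: "\<And>i. i < l \<Longrightarrow> (w i, w (Suc i mod l)) \<in> parcs G"
    and far: "\<And>i j n. i \<le> j \<Longrightarrow> j < l \<Longrightarrow> (w i, w j) \<in> parcs G ^^ n \<Longrightarrow> j - i \<le> n \<or> l - (j - i) \<le> n"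
  shows "isometric_subgraph (cycle_graph (cyclic_walk w l)) G"
proof -
  interpret pair_graph G by fact
  have wf: "pair_wf_digraph G" ..
  let ?p = "cyclic_walk w l"
  let ?H = "cycle_graph ?p"
  have symG: "sym (parcs G)" by (auto simp: sym_def intro: arcs_symmetric)
  have pv: "pverts ?H = w ` {..<l}"
    by (auto simp: cycle_graph_def set_cyclic_walk image_iff)
  have pa: "parcs ?H = set ?p \<union> (set ?p)\<inverse>" by (simp add: cycle_graph_def)
  have sub: "parcs ?H \<subseteq> parcs G"
    unfolding pa using arcs symG by (auto simp: set_cyclic_walk sym_def)
  have subv: "pverts ?H \<subseteq> pverts G"
    unfolding pv using arcs in_arcsD1 by auto
  have inv: "u \<in> pverts ?H \<and> v \<in> pverts ?H" if "(u, v) \<in> parcs ?H" for u v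
    using that l(1) unfolding pv pa by (auto simp: set_cyclic_walk)
  have H: "pair_graph ?H"
  proof
    show "finite (pverts ?H)" unfolding pv by simp
    show "finite (parcs ?H)" unfolding pa by simp
    show "symmetric (with_proj ?H)" unfolding symmetric_def with_proj_simps pa
      by (auto simp: sym_def)
  qed (use inv sub no_loops in auto)
  then interpret H: pair_graph ?H .
  have wfH: "pair_wf_digraph ?H" ..
  have "subgraph (with_proj ?H) (with_proj G)"
    using sub subv by (intro subgraphI) (auto intro: wf_digraph_axioms H.wf_digraph_axioms)
  moreover have step: "(w (a mod l), w ((a + n) mod l)) \<in> parcs ?H ^^ n" for a n
    by (rule relpow_cyclic) (use l in \<open>auto simp: pa set_cyclic_walk\<close>)
  have le: "gdist ?H (w i) (w j) = gdist G (w i) (w j)" if ij: "i \<le> j" "j < l" for i j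
  proof -
    have V: "w i \<in> pverts ?H" "w j \<in> pverts ?H" using ij pv by auto
    have "(w i, w j) \<in> parcs ?H ^^ (j - i)" using step[of i "j - i"] ij by simp
    moreover have "(w j, w i) \<in> parcs ?H ^^ (l - (j - i))"
      using step[of j "l - (j - i)"] ij by (simp add: mod_if)
    then have "(w i, w j) \<in> parcs ?H ^^ (l - (j - i))"
      by (rule relpow_sym[rotated]) (auto simp: sym_def pa)
    ultimately have "gdist ?H (w i) (w j) \<le> j - i" "gdist ?H (w i) (w j) \<le> l - (j - i)"
      and r: "(w i, w j) \<in> (parcs ?H)\<^sup>*"
      using gdist_le[OF wfH V(1)] by (auto intro: relpow_imp_rtrancl)
    moreover have rG: "(w i, w j) \<in> (parcs G)\<^sup>*" using r rtrancl_mono[OF sub] by blast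
    from gdist_attained[OF wf _ this] have "j - i \<le> gdist G (w i) (w j) \<or> l - (j - i) \<le> gdist G (w i) (w j)"
      using far[OF ij] V(1) subv by blast
    moreover have "gdist G (w i) (w j) \<le> gdist ?H (w i) (w j)"
      using gdist_le[OF wf subsetD[OF subv V(1)]] relpow_mono_rel[OF gdist_attained[OF wfH V(1) r] sub]
      by blast
    ultimately show ?thesis by linarith
  qed
  have conH: "(w i, w j) \<in> (parcs ?H)\<^sup>*" if "i < l" "j < l" for i j
  proof -
    have "(w 0, w i) \<in> (parcs ?H)\<^sup>*" if "i < l" for i
      using step[of 0 i] that by (auto intro: relpow_imp_rtrancl)
    moreover have "sym ((parcs ?H)\<^sup>*)" by (rule sym_rtrancl) (auto simp: sym_def pa)
    ultimately show ?thesis using that by (meson rtrancl_trans symD)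
  qed
  have "gdist ?H (w i) (w j) = gdist G (w i) (w j)" if ij: "i < l" "j < l" for i j
  proof (cases "i \<le> j")
    case True
    then show ?thesis using le ij by simp
  next
    case False
    have "gdist ?H (w i) (w j) = gdist ?H (w j) (w i)"
      using gdist_commute[OF H _ _ conH[OF ij]] ij pv by auto
    also have "\<dots> = gdist G (w j) (w i)" using le ij False by simp
    also have "\<dots> = gdist G (w i) (w j)"
      using gdist_commute[OF G, of "w j" "w i"] subv pv ij rtrancl_mono[OF sub] conH[OF ij(2,1)] by blast
    finally show ?thesis .
  qed
  ultimately show ?thesis unfolding isometric_subgraph_def using H pv by auto
qed

text \<open>The supremum in \<open>nat\<close> needs a bounded set: the arcs of a cycle are
  distinct, so there are at most \<open>card (parcs G)\<close> of them.\<close>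

lemma iso_length_ge:
  assumes "pair_graph G" "pre_digraph.cycle (with_proj G) p" "3 \<le> length p"
    "isometric_subgraph (cycle_graph p) G"
  shows "length p \<le> iso_length G"
proof -
  interpret pair_graph G by fact
  have "length q \<le> card (parcs G)" if "cycle q" for q
  proof -
    have "distinct q" "set q \<subseteq> parcs G" using that unfolding cycle_conv by auto
    then show ?thesis using pair_finite_arcs by (metis card_mono distinct_card)
  qed
  then show ?thesis
    unfolding iso_length_def using assms(2-4)
    by (intro cSup_upper) (auto intro!: bdd_aboveI[of _ "card (parcs G)"])
qed

lemma relpow_avoid_or_use:
  fixes A :: "('a \<times> 'a) set"
  assumes "(u, v) \<in> A ^^ n"
  shows "(u, v) \<in> (A - E) ^^ n \<or>
    (\<exists>a b k m. (a, b) \<in> E \<and> (u, a) \<in> A ^^ k \<and> (b, v) \<in> A ^^ m \<and> n = Suc (k + m))"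
  using assms
proof (induction n arbitrary: v)
  case (Suc n)
  obtain w where w: "(u, w) \<in> A ^^ n" "(w, v) \<in> A" using Suc.prems by auto
  show ?case
  proof (cases "(w, v) \<in> E")
    case True
    then show ?thesis using w by (metis add_0_right relpow_0_I)
  next
    case False
    from Suc.IH[OF w(1)] show ?thesis
    proof
      assume "(u, w) \<in> (A - E) ^^ n"
      then show ?thesis using w(2) False by auto
    next
      assume "\<exists>a b k m. (a, b) \<in> E \<and> (u, a) \<in> A ^^ k \<and> (b, w) \<in> A ^^ m \<and> n = Suc (k + m)"
      then obtain a b k m where "(a, b) \<in> E" "(u, a) \<in> A ^^ k" "(b, w) \<in> A ^^ m" "n = Suc (k + m)"
        by blast
      moreover from this have "(b, v) \<in> A ^^ Suc m" using w(2) by auto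
      ultimately show ?thesis by (metis add_Suc_right)
    qed
  qed
qed simp

text \<open>A shortest cycle through a given edge is isometric.\<close>

lemma detour_less_iso_length:
  assumes G: "bridgeless_graph G" and xy: "(x, y) \<in> parcs G"
  shows "\<exists>q. (y, x) \<in> (parcs G - {(x, y), (y, x)}) ^^ q \<and> q < iso_length G"
proof -
  have pg: "pair_graph G" and con: "connected (with_proj G)" and nb: "\<not> bridge G x y"
    using G by (auto simp: bridgeless_graph_def)
  interpret pair_graph G by (fact pg)
  have wf: "pair_wf_digraph G" ..
  let ?A = "parcs G" and ?B = "parcs G - {(x, y), (y, x)}"
  have symA: "sym ?A" and symB: "sym ?B" by (auto simp: sym_def intro: arcs_symmetric)
  have "(x, y) \<in> ?B\<^sup>*"
    using connected_remove_edge_iff[OF pg xy con] nb xy by (simp add: bridge_def)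
  then have ex: "\<exists>q. (y, x) \<in> ?B ^^ q"
    by (meson rtrancl_imp_relpow symB relpow_sym)
  \<comment> \<open>A shortest detour, which together with the edge forms a cycle of length
    \<open>q + 1\<close>.\<close>
  define q where "q = (LEAST q. (y, x) \<in> ?B ^^ q)"
  have q: "(y, x) \<in> ?B ^^ q" unfolding q_def using ex by (rule LeastI_ex)
  have q_le: "q \<le> m" if "(y, x) \<in> ?B ^^ m" for m unfolding q_def using that by (rule Least_le)
  obtain w where w: "w 0 = y" "w q = x" "\<And>i. i < q \<Longrightarrow> (w i, w (Suc i)) \<in> ?B"
    using q unfolding relpow_fun_conv by blast
  have sub: "(w i, w j) \<in> ?B ^^ (j - i)" if "i \<le> j" "j \<le> q" for i j
    using relpow_chain[of "j - i" "\<lambda>t. w (i + t)" ?B] w(3) that by simp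
  have short: "j - i \<le> n" if "i \<le> j" "j \<le> q" "(w i, w j) \<in> ?B ^^ n" for i j n
  proof -
    have "(y, x) \<in> ?B ^^ (i + n + (q - j))"
      using relpow_appendI[OF relpow_appendI[OF sub[of 0 i] that(3)] sub[of j q]] that w by simp
    then show ?thesis using q_le that by fastforce
  qed
  \<comment> \<open>A walk avoiding the edge cannot beat the shortest detour. One that uses it
    splits there into two shorter walks between vertices of the cycle.\<close>
  have far: "j - i \<le> n \<or> Suc q - (j - i) \<le> n"
    if "i \<le> j" "j \<le> q" "(w i, w j) \<in> ?A ^^ n" for i j n
    using that
  proof (induction n arbitrary: i j rule: less_induct)
    case (less n)
    from relpow_avoid_or_use[OF less.prems(3), of "{(x, y), (y, x)}"] show ?case
    proof (elim disjE exE conjE)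
      assume "(w i, w j) \<in> ?B ^^ n"
      then show ?thesis using short less.prems by blast
    next
      fix a b k m
      assume ab: "(a, b) \<in> {(x, y), (y, x)}"
        and k: "(w i, a) \<in> ?A ^^ k" and m: "(b, w j) \<in> ?A ^^ m" and n: "n = Suc (k + m)"
      from ab consider "a = w q" "b = w 0" | "a = w 0" "b = w q" using w by auto
      then show ?thesis
      proof cases
        case 1
        then show ?thesis
          using less.IH[of k i q] less.IH[of m 0 j] k m n less.prems by auto
      next
        case 2
        then show ?thesis
          using less.IH[of k 0 i] less.IH[of m j q] relpow_sym[OF symA k] relpow_sym[OF symA m]
            n less.prems by auto
      qed
    qed
  qed
  have inj: "inj_on w {..<Suc q}"
  proof (rule linorder_inj_onI)
    fix i j assume "i < j" "i \<in> {..<Suc q}" "j \<in> {..<Suc q}"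
    then show "w i \<noteq> w j" using short[of i j 0] by auto
  qed auto
  have "q \<noteq> 0" using w(1,2) no_loops'[OF xy] by (cases "q = 0") auto
  moreover have "q \<noteq> 1" using q by auto
  ultimately have q2: "2 \<le> q" by linarith
  have arcs: "(w i, w (Suc i mod Suc q)) \<in> ?A" if "i < Suc q" for i
    using that w xy by (cases "i = q") auto
  have "Suc q \<le> iso_length G"
    using iso_length_ge[OF pg cycle_cyclic_walk[OF wf _ inj arcs]
        _ isometric_cyclic_walk[OF pg _ inj arcs]] far q2 by simp
  with q show ?thesis by (intro exI[of _ q]) simp
qed

section \<open>Iterating the enlargement from a centre\<close>

lemma rc_upper_bound:
  assumes G: "bridgeless_graph G"
  shows "\<exists>c. rainbow_colouring G c \<and> card (c ` edges G) \<le> (\<Sum>i=1..radius G. min (2 * i + 1) (iso_length G))"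
proof -
  have pg: "pair_graph G" and con: "connected (with_proj G)"
    using G by (auto simp: bridgeless_graph_def)
  interpret pair_graph G by (fact pg)
  have wf: "pair_wf_digraph G" ..
  let ?A = "parcs G" and ?V = "pverts G"
  define r where "r = radius G"
  define z where "z = iso_length G"
  have symA: "sym ?A" by (auto simp: sym_def intro: arcs_symmetric)
  have AV: "?A \<subseteq> ?V \<times> ?V" using in_arcsD1 in_arcsD2 by auto
  have V: "?V \<noteq> {}" "\<And>u v. u \<in> ?V \<Longrightarrow> v \<in> ?V \<Longrightarrow> (u, v) \<in> ?A\<^sup>*"
    using con connected_iff_rtrancl[OF symA] AV by auto
  have "r \<in> (\<lambda>v. Max (gdist G v ` ?V)) ` ?V"
    unfolding r_def radius_def using V(1) pair_finite_verts by (intro Min_in) auto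
  then obtain v where v: "v \<in> ?V" "r = Max (gdist G v ` ?V)" by blast
  have ecc: "gdist G v x \<le> r" if "x \<in> ?V" for x
    using v that pair_finite_verts by simp
  \<comment> \<open>After \<open>m\<close> rounds \<open>D\<close> is \<open>(r - m)\<close>-step
    dominating, and the summands with \<open>i > r - m\<close> are spent.\<close>
  have "\<exists>D c. D \<subseteq> ?V \<and> (\<forall>x \<in> ?V. \<exists>u \<in> D. \<exists>t \<le> r - m. (u, x) \<in> ?A ^^ t) \<and>
      (\<forall>u v. u \<in> D \<longrightarrow> v \<in> D \<longrightarrow> (\<exists>S. rainbow_reach (?A \<inter> D \<times> D) c u v S)) \<and>
      (\<forall>u v. (u, v) \<in> ?A \<longrightarrow> u \<in> D \<longrightarrow> v \<in> D \<longrightarrow> c {u, v} < (\<Sum>i=Suc (r - m)..r. min (2 * i + 1) z))"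
    if "m \<le> r" for m
    using that
  proof (induction m)
    case 0
    show ?case
    proof (intro exI[of _ "{v}"] exI[of _ "\<lambda>_. 0"] conjI allI impI ballI)
      fix x assume x: "x \<in> ?V"
      show "\<exists>u \<in> {v}. \<exists>t \<le> r - 0. (u, x) \<in> ?A ^^ t"
        using gdist_attained[OF wf v(1) V(2)[OF v(1) x]] ecc[OF x] by auto
    next
      fix a b assume "a \<in> {v}" "b \<in> {v}"
      then show "\<exists>S. rainbow_reach (?A \<inter> {v} \<times> {v}) (\<lambda>_. 0) a b S"
        using rainbow_reach.refl by fastforce
    next
      \<comment> \<open>The sum is empty here, but a single vertex spans no arc.\<close>
      fix a b assume "(a, b) \<in> ?A" "a \<in> {v}" "b \<in> {v}"
      then show "0 < (\<Sum>i=Suc (r - 0)..r. min (2 * i + 1) z)" using no_loops' by blast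
    qed (use v in auto)
  next
    case (Suc m)
    \<comment> \<open>The round leads from \<open>(k + 1)\<close>-step to \<open>k\<close>-step
      domination and pays for the summand \<open>i = k + 1\<close>.\<close>
    define k where "k = r - Suc m"
    have k: "r - m = Suc k" "Suc k \<le> r" using Suc.prems by (auto simp: k_def)
    obtain D c where D: "D \<subseteq> ?V" "\<And>x. x \<in> ?V \<Longrightarrow> \<exists>u \<in> D. \<exists>t \<le> Suc k. (u, x) \<in> ?A ^^ t"
      "\<And>u v. u \<in> D \<Longrightarrow> v \<in> D \<Longrightarrow> \<exists>S. rainbow_reach (?A \<inter> D \<times> D) c u v S"
      "\<And>u v. (u, v) \<in> ?A \<Longrightarrow> u \<in> D \<Longrightarrow> v \<in> D \<Longrightarrow> c {u, v} < (\<Sum>i=Suc (Suc k)..r. min (2 * i + 1) z)"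
      using Suc.IH Suc.prems unfolding k by (metis Suc_leD)
    interpret dominated_graph ?V ?A D
    proof
      fix x assume "x \<in> ?V"
      then show "\<exists>u \<in> D. (u, x) \<in> ?A\<^sup>*" using D(2) by (meson relpow_imp_rtrancl)
    qed (use pair_finite_verts AV symA D(1) in auto)
    have deep: "depth x \<le> Suc k" if "x \<in> ?V" for x
      using D(2)[OF that] depth_le by (meson le_trans)
    have detour: "\<exists>q. (y, x) \<in> (?A - {(x, y), (y, x)}) ^^ q \<and> q < z" if "(x, y) \<in> ?A" for x y
      using detour_less_iso_length[OF G that] unfolding z_def .
    have "\<exists>D' c'. D \<subseteq> D' \<and> D' \<subseteq> ?V \<and> (\<forall>x \<in> ?V. \<exists>u \<in> D'. \<exists>m \<le> k. (u, x) \<in> ?A ^^ m) \<and>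
      (\<forall>u v. u \<in> D' \<longrightarrow> v \<in> D' \<longrightarrow> (\<exists>S. rainbow_reach (?A \<inter> D' \<times> D') c' u v S)) \<and>
      (\<forall>u v. (u, v) \<in> ?A \<longrightarrow> u \<in> D' \<longrightarrow> v \<in> D' \<longrightarrow>
        c' {u, v} < (\<Sum>i=Suc (Suc k)..r. min (2 * i + 1) z) + min (2 * k + 3) z)"
      using deep detour D(3,4) by (rule extend_rainbow)
    moreover have "(\<Sum>i=Suc (Suc k)..r. min (2 * i + 1) z) + min (2 * k + 3) z = (\<Sum>i=Suc k..r. min (2 * i + 1) z)"
      using sum.atLeast_Suc_atMost[of "Suc k" r "\<lambda>i. min (2 * i + 1) z"] k(2)
      by (simp add: numeral_3_eq_3)
    ultimately show ?case unfolding k_def[symmetric] by auto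
  qed
  from this[of r] obtain D c where D: "D \<subseteq> ?V" "\<forall>x \<in> ?V. x \<in> D"
      "\<forall>u v. u \<in> D \<longrightarrow> v \<in> D \<longrightarrow> (\<exists>S. rainbow_reach (?A \<inter> D \<times> D) c u v S)"
      "\<forall>u v. (u, v) \<in> ?A \<longrightarrow> u \<in> D \<longrightarrow> v \<in> D \<longrightarrow> c {u, v} < (\<Sum>i=1..r. min (2 * i + 1) z)"
    by fastforce
  have "D = ?V" "?A \<inter> ?V \<times> ?V = ?A" using D(1,2) AV by auto
  then have "rainbow_colouring G c"
    using D(3) rainbow_reach_imp_rainbow_path[OF wf] unfolding rainbow_colouring_def by metis
  moreover have "c ` edges G \<subseteq> {..<\<Sum>i=1..r. min (2 * i + 1) z}"
    using D(2,4) AV by (auto simp: edges_def)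
  then have "card (c ` edges G) \<le> (\<Sum>i=1..r. min (2 * i + 1) z)"
    using card_mono[of "{..<\<Sum>i=1..r. min (2 * i + 1) z}"] by simp
  ultimately show ?thesis unfolding r_def z_def by blast
qed

section \<open>Cycles and cuts\<close>

lemma awalk_crosses:
  assumes "pair_wf_digraph G" "pre_digraph.awalk (with_proj G) u p v" "u \<in> T" "v \<notin> T"
  shows "\<exists>x y. (x, y) \<in> set p \<and> x \<in> T \<and> y \<notin> T"
proof -
  interpret pair_wf_digraph G by fact
  show ?thesis using assms(2-)
  proof (induction p arbitrary: u)
    case (Cons e p)
    then have e: "e = (u, snd e)" "awalk (snd e) p v"
      by (auto simp: awalk_Cons_iff)
    show ?case
    proof (cases "snd e \<in> T")
      case True
      then show ?thesis using Cons.IH[OF e(2) _ Cons.prems(3)] by auto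
    next
      case False
      then show ?thesis using e(1) Cons.prems(2) by (metis list.set_intros(1))
    qed
  qed (auto simp: awalk_Nil_iff)
qed

text \<open>The rest of the closed walk, suitably rotated, leads from \<open>y\<close> back to
  \<open>x\<close>.\<close>

lemma cycle_crosses_back:
  assumes "pair_wf_digraph G" "pre_digraph.cycle (with_proj G) p"
    "(x, y) \<in> set p" "x \<notin> T" "y \<in> T"
  shows "\<exists>x y. (x, y) \<in> set p \<and> x \<in> T \<and> y \<notin> T"
proof -
  interpret pair_wf_digraph G by fact
  obtain u where u: "awalk u p u" using assms(2) by (auto simp: cycle_def)
  obtain p1 p2 where p: "p = p1 @ (x, y) # p2" using assms(3) by (meson split_list)
  have "awalk u p1 x" "awalk y p2 u"
    using u unfolding p by (auto simp: awalk_Cons_iff)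
  then have "awalk y (p2 @ p1) x" by (rule awalk_appendI[rotated])
  from awalk_crosses[OF assms(1) this assms(5,4)] show ?thesis unfolding p by auto
qed

text \<open>Every vertex of a cycle is the tail of exactly one of its arcs. So \<open>S\<close>
  contains with each arc the next one, and hence all.\<close>

lemma cycle_closed_arcs:
  assumes "pair_wf_digraph G" "pre_digraph.cycle (with_proj G) p"
    "S \<subseteq> set p" "S \<noteq> {}" "snd ` S \<subseteq> fst ` S"
  shows "S = set p"
proof -
  interpret pair_wf_digraph G by fact
  obtain u where u: "awalk u p u" "distinct (tl (awalk_verts u p))" "p \<noteq> []"
    using assms(2) by (auto simp: cycle_def)
  let ?n = "length p"
  have hd: "fst (hd p) = u" using u(1,3) by (cases p) (auto simp: awalk_Cons_iff)
  have last: "snd (last p) = u" using u(1,3) awlast_of_awalk[OF u(1)] awalk_verts_conv[of u p] by auto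
  have "distinct (map fst p)"
  proof -
    have "tl (awalk_verts u p) = tl (map fst p) @ [u]"
      using u(3) last by (simp add: awalk_verts_conv)
    moreover have "map fst p = u # tl (map fst p)" using hd u(3) by (cases p) auto
    ultimately show ?thesis using u(2) by (metis distinct.simps(2) distinct_append disjoint_insert(1)
        list.set(1) list.set(2) inf_commute)
  qed
  then have inj: "inj_on fst (set p)" by (simp add: distinct_map)
  have succ: "snd (p ! i) = fst (p ! (Suc i mod ?n))" if "i < ?n" for i
  proof (cases "Suc i < ?n")
    case True
    then have "p = take i p @ p ! i # p ! Suc i # drop (Suc (Suc i)) p"
      using that by (metis Cons_nth_drop_Suc append_take_drop_id)
    then have "awalk u (take i p @ p ! i # p ! Suc i # drop (Suc (Suc i)) p) u" using u(1) by simp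
    then have "snd (p ! i) = fst (p ! Suc i)" by (auto simp: awalk_Cons_iff simp del: awalk_verts_with_proj_eq)
    then show ?thesis using True by simp
  next
    case False
    then have "Suc i = ?n" using that by simp
    then have "i = ?n - 1" "Suc i mod ?n = 0" by simp_all
    then show ?thesis using hd last u(3) by (simp add: last_conv_nth hd_conv_nth)
  qed
  obtain i0 where i0: "i0 < ?n" "p ! i0 \<in> S"
    using assms(3,4) by (metis all_not_in_conv in_set_conv_nth subsetD)
  have "p ! ((i0 + k) mod ?n) \<in> S" for k
  proof (induction k)
    case (Suc k)
    let ?i = "(i0 + k) mod ?n"
    have i: "?i < ?n" using u(3) by simp
    have "snd (p ! ?i) \<in> fst ` S" using Suc.IH assms(5) by blast
    then obtain e where e: "e \<in> S" "fst e = fst (p ! (Suc ?i mod ?n))" using succ[OF i] by auto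
    then have "e = p ! (Suc ?i mod ?n)"
      using inj assms(3) u(3) by (intro inj_onD[OF inj]) auto
    then show ?case using e(1) by (simp add: mod_Suc_eq)
  qed (use i0 in simp)
  then have "p ! i \<in> S" if "i < ?n" for i
  proof -
    have "(i0 + (?n - i0 + i)) mod ?n = i" using i0(1) that by simp
    then show ?thesis using \<open>\<And>k. p ! ((i0 + k) mod ?n) \<in> S\<close> by metis
  qed
  then show ?thesis using assms(3) by (metis in_set_conv_nth subsetI subset_antisym)
qed

text \<open>If \<open>pos\<close> retracts the graph onto the closed walk \<open>w\<close>, contracting every other arc, then any
  two edges of \<open>w\<close> form an edge cut. So a cycle containing one arc of \<open>w\<close> contains all of them.\<close>

lemma cycle_through_retract:
  assumes G: "pair_wf_digraph G" and p: "pre_digraph.cycle (with_proj G) p" "3 \<le> length p"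
    and inv: "\<And>i. i < l \<Longrightarrow> pos (w i) = i"
    and arcs: "\<And>u v. (u, v) \<in> parcs G \<Longrightarrow> pos u \<noteq> pos v \<Longrightarrow>
      \<exists>i<l. (u, v) = (w i, w (Suc i mod l)) \<or> (u, v) = (w (Suc i mod l), w i)"
    and t: "t < l" "(w t, w (Suc t mod l)) \<in> set p"
  shows "length p \<le> l"
proof -
  interpret pair_wf_digraph G by fact
  have dp: "distinct p" and pG: "set p \<subseteq> parcs G" using p(1) unfolding cycle_conv by auto
  \<comment> \<open>Two opposite arcs are closed under succession and would already be the whole
    cycle.\<close>
  have no_back: "(y, x) \<notin> set p" if "(x, y) \<in> set p" for x y
  proof
    assume "(y, x) \<in> set p"
    then have "{(x, y), (y, x)} = set p"
      using that by (intro cycle_closed_arcs[OF G p(1)]) auto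
    then have "card (set p) \<le> 2" by (metis card_length length_Cons list.set(1,2) list.size(3) numeral_2_eq_2)
    then show False using p(2) distinct_card[OF dp] by simp
  qed
  have lmod: "Suc i mod l = (if Suc i = l then 0 else Suc i)" if "i < l" for i
    using that by auto
  have all: "(w s, w (Suc s mod l)) \<in> set p" if s: "s < l" for s
  proof -
    consider "s = t" | "t < s" | "s < t" by linarith
    then show ?thesis
    proof cases
      case 1
      then show ?thesis using t by simp
    next
      case 2
      \<comment> \<open>Only the edges number \<open>t\<close> and \<open>s\<close> of
        \<open>w\<close> join \<open>T\<close> to its complement. The cycle enters \<open>T\<close>
        by edge \<open>t\<close> and has to leave it by edge \<open>s\<close>.\<close>
      define T where "T = {x. t < pos x \<and> pos x \<le> s}"
      have "w t \<notin> T" "w (Suc t mod l) \<in> T"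
        using 2 s t(1) inv[of t] inv[of "Suc t"] by (auto simp: T_def lmod)
      then obtain x y where xy: "(x, y) \<in> set p" "x \<in> T" "y \<notin> T"
        using cycle_crosses_back[OF G p(1) t(2)] by blast
      then have "pos x \<noteq> pos y" "(x, y) \<in> parcs G" using pG by (auto simp: T_def)
      then obtain i where i: "i < l" and
        "(x, y) = (w i, w (Suc i mod l)) \<or> (x, y) = (w (Suc i mod l), w i)"
        using arcs by blast
      then show ?thesis
      proof (elim disjE)
        assume e: "(x, y) = (w i, w (Suc i mod l))"
        then have "i = s" using xy(2,3) i s inv[of i] inv[of "Suc i mod l"]
          by (auto simp: T_def lmod split: if_splits)
        then show ?thesis using e xy(1) by simp
      next
        assume e: "(x, y) = (w (Suc i mod l), w i)"
        then have "i = t" using xy(2,3) i s t(1) inv[of i] inv[of "Suc i mod l"]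
          by (auto simp: T_def lmod split: if_splits)
        then show ?thesis using e xy(1) no_back t(2) by blast
      qed
    next
      case 3
      \<comment> \<open>The positions from \<open>t + 1\<close> round to \<open>s\<close> now wrap
        past 0, so \<open>T\<close> is given by its complement.\<close>
      define T where "T = {x. \<not> (s < pos x \<and> pos x \<le> t)}"
      have "w t \<notin> T" "w (Suc t mod l) \<in> T"
        using 3 t(1) inv[of t] inv[of "Suc t mod l"] by (auto simp: T_def lmod split: if_splits)
      then obtain x y where xy: "(x, y) \<in> set p" "x \<in> T" "y \<notin> T"
        using cycle_crosses_back[OF G p(1) t(2)] by blast
      then have "pos x \<noteq> pos y" "(x, y) \<in> parcs G" using pG by (auto simp: T_def)
      then obtain i where i: "i < l" and
        "(x, y) = (w i, w (Suc i mod l)) \<or> (x, y) = (w (Suc i mod l), w i)"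
        using arcs by blast
      then show ?thesis
      proof (elim disjE)
        assume e: "(x, y) = (w i, w (Suc i mod l))"
        then have "i = s" using xy(2,3) i s t(1) inv[of i] inv[of "Suc i mod l"]
          by (auto simp: T_def lmod split: if_splits)
        then show ?thesis using e xy(1) by simp
      next
        assume e: "(x, y) = (w (Suc i mod l), w i)"
        then have "i = t" using xy(2,3) i s t(1) inv[of i] inv[of "Suc i mod l"]
          by (auto simp: T_def lmod split: if_splits)
        then show ?thesis using e xy(1) no_back t(2) by blast
      qed
    qed
  qed
  let ?S = "(\<lambda>i. (w i, w (Suc i mod l))) ` {..<l}"
  have "?S = set p"
  proof (rule cycle_closed_arcs[OF G p(1)])
    show "snd ` ?S \<subseteq> fst ` ?S" using t(1) by (auto simp: image_image image_iff)
  qed (use all t in auto)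
  then have "length p = card ?S" using distinct_card[OF dp] by simp
  also have "\<dots> \<le> l" using card_image_le[of "{..<l}"] by (metis card_lessThan finite_lessThan)
  finally show ?thesis .
qed

text \<open>If the cycle runs backwards along \<open>w\<close>, positions are reflected by
  \<open>l - 1 - i\<close>.\<close>

lemma cycle_through_retract_edge:
  assumes G: "pair_wf_digraph G" and p: "pre_digraph.cycle (with_proj G) p" "3 \<le> length p"
    and inv: "\<And>i. i < l \<Longrightarrow> pos (w i) = i"
    and arcs: "\<And>u v. (u, v) \<in> parcs G \<Longrightarrow> pos u \<noteq> pos v \<Longrightarrow>
      \<exists>i<l. (u, v) = (w i, w (Suc i mod l)) \<or> (u, v) = (w (Suc i mod l), w i)"
    and t: "t < l" "(w t, w (Suc t mod l)) \<in> set p \<or> (w (Suc t mod l), w t) \<in> set p"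
  shows "length p \<le> l"
  using t(2)
proof
  assume t': "(w (Suc t mod l), w t) \<in> set p"
  define w' where "w' i = w (l - 1 - i)" for i
  have flip: "\<exists>k<l. w' k = w (Suc i mod l) \<and> w' (Suc k mod l) = w i" if "i < l" for i
  proof (cases "Suc i = l")
    case True
    then show ?thesis by (intro exI[of _ i]) (auto simp: w'_def)
  next
    case False
    then have "Suc (l - 2 - i) < l" "l - 1 - (l - 2 - i) = Suc i" "l - 1 - Suc (l - 2 - i) = i"
      using that by auto
    then show ?thesis using False that
      by (intro exI[of _ "l - 2 - i"]) (auto simp: w'_def)
  qed
  obtain k where k: "k < l" "(w' k, w' (Suc k mod l)) \<in> set p" using flip[OF t(1)] t' by metis
  show ?thesis
  proof (rule cycle_through_retract[OF G p, where pos = "\<lambda>x. l - 1 - pos x" and w = w', OF _ _ k])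
    fix u v assume "(u, v) \<in> parcs G" "l - 1 - pos u \<noteq> l - 1 - pos v"
    then obtain i where i: "i < l" "(u, v) = (w i, w (Suc i mod l)) \<or> (u, v) = (w (Suc i mod l), w i)"
      using arcs by metis
    then show "\<exists>i<l. (u, v) = (w' i, w' (Suc i mod l)) \<or> (u, v) = (w' (Suc i mod l), w' i)"
      using flip[OF i(1)] by metis
  qed (use inv in \<open>simp add: w'_def\<close>)
qed (use cycle_through_retract[OF G p inv arcs] t in blast)

lemma cyclic_edge_inj:
  fixes i j l :: nat
  assumes "3 \<le> l" "i < l" "j < l" "{i, Suc i mod l} = {j, Suc j mod l}"
  shows "i = j"
proof -
  have "Suc k mod l = (if Suc k = l then 0 else Suc k)" if "k < l" for k using that by auto
  then show ?thesis using assms by (auto simp: doubleton_eq_iff split: if_splits)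
qed

section \<open>The extremal graph\<close>

text \<open>The extremal graph consists of \<open>M\<close> chains of cycles glued at a common vertex. In every chain
  the cycle with index \<open>j\<close> starts (position \<open>0\<close>) at the vertex at position \<open>1\<close> of the cycle with
  index \<open>j - 1\<close>. Position \<open>t > 0\<close> of cycle \<open>j\<close> of chain \<open>m\<close> is coded by the triple \<open>(m, j + 1, t)\<close> and
  the common vertex by \<open>(0, 0, 0)\<close>.\<close>

locale cactus =
  fixes r z M :: nat
  assumes r: "1 \<le> r" and z: "3 \<le> z" "z \<le> 2 * r + 1" and M: "2 \<le> M"
begin

text \<open>Triples are packed into naturals because the vertices are to have type
  \<open>nat\<close>.\<close>

definition code :: "nat \<Rightarrow> nat \<Rightarrow> nat \<Rightarrow> nat" where
  "code m j t = prod_encode (m, prod_encode (j, t))"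

definition chain_of :: "nat \<Rightarrow> nat" where
  "chain_of v = fst (prod_decode v)"

definition level :: "nat \<Rightarrow> nat" where
  "level v = fst (prod_decode (snd (prod_decode v)))"

definition index :: "nat \<Rightarrow> nat" where
  "index v = snd (prod_decode (snd (prod_decode v)))"

lemma code_simps [simp]:
  "chain_of (code m j t) = m" "level (code m j t) = j" "index (code m j t) = t"
  by (simp_all add: code_def chain_of_def level_def index_def)

text \<open>Cycle \<open>j\<close> realises the summand \<open>i = r - j\<close>, so lengths do not
  increase away from the common vertex.\<close>

definition len :: "nat \<Rightarrow> nat" where
  "len j = min (2 * (r - j) + 1) z"

text \<open>Cycle \<open>j\<close> starts at \<open>joint m j\<close>, and \<open>joint m r\<close>
  is the far end of the chain.\<close>

definition joint :: "nat \<Rightarrow> nat \<Rightarrow> nat" where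
  "joint m j = (if j = 0 then code 0 0 0 else code m j 1)"

definition vert :: "nat \<Rightarrow> nat \<Rightarrow> nat \<Rightarrow> nat" where
  "vert m j t = (if t = 0 then joint m j else code m (Suc j) t)"

definition cactus_graph :: "nat pair_pre_digraph" where
  "cactus_graph = \<lparr>
    pverts = {vert m j t |m j t. m < M \<and> j < r \<and> t < len j},
    parcs = {(vert m j t, vert m j (Suc t mod len j)) |m j t. m < M \<and> j < r \<and> t < len j} \<union>
      {(vert m j (Suc t mod len j), vert m j t) |m j t. m < M \<and> j < r \<and> t < len j}\<rparr>"

abbreviation "V \<equiv> pverts cactus_graph"
abbreviation "A \<equiv> parcs cactus_graph"

text \<open>A retraction onto cycle \<open>j\<close> of chain \<open>m\<close>: what lies beyond its
  far joint goes to position 1, everything else off the cycle to position 0.\<close>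

definition pos :: "nat \<Rightarrow> nat \<Rightarrow> nat \<Rightarrow> nat" where
  "pos m j v = (if chain_of v \<noteq> m \<or> level v \<le> j then 0 else if level v = Suc j then index v else 1)"

text \<open>Height grows by at most one along an arc and is 0 outside chain \<open>m\<close>, which
  bounds distances to the end of that chain from below.\<close>

definition height :: "nat \<Rightarrow> nat \<Rightarrow> nat" where
  "height m v = (if chain_of v = m then level v else 0)"

lemma len_ge_3: "j < r \<Longrightarrow> 3 \<le> len j"
  using z by (simp add: len_def)

lemma V_iff: "v \<in> V \<longleftrightarrow> (\<exists>m j t. v = vert m j t \<and> m < M \<and> j < r \<and> t < len j)"
  by (simp add: cactus_graph_def)

lemma A_iff: "(u, v) \<in> A \<longleftrightarrow> (\<exists>m j t. m < M \<and> j < r \<and> t < len j \<and>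
    ((u, v) = (vert m j t, vert m j (Suc t mod len j)) \<or> (u, v) = (vert m j (Suc t mod len j), vert m j t)))"
  unfolding cactus_graph_def by auto

lemma pos_vert: "pos m j (vert m j t) = t"
  by (simp add: pos_def vert_def joint_def)

lemma pos_vert_other:
  "(m', j') \<noteq> (m, j) \<Longrightarrow> pos m j (vert m' j' t) = (if m' = m \<and> j < j' then 1 else 0)"
  by (auto simp: pos_def vert_def joint_def)

lemma height_vert: "height m (vert m' j t) = (if m' = m then (if t = 0 then j else Suc j) else 0)"
  by (auto simp: height_def vert_def joint_def)

lemma joint_vert: "joint m (Suc j) = vert m j 1" "joint m j = vert m j 0"
  by (simp_all add: joint_def vert_def)

lemma pos_arc:
  assumes "(u, v) \<in> A" "pos m j u \<noteq> pos m j v"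
  shows "\<exists>i<len j. (u, v) = (vert m j i, vert m j (Suc i mod len j)) \<or>
    (u, v) = (vert m j (Suc i mod len j), vert m j i)"
proof -
  obtain m' j' t where *: "m' < M" "j' < r" "t < len j'"
      "(u, v) = (vert m' j' t, vert m' j' (Suc t mod len j')) \<or>
       (u, v) = (vert m' j' (Suc t mod len j'), vert m' j' t)"
    using assms(1) A_iff by blast
  have "(m', j') = (m, j)"
  proof (rule ccontr)
    assume "(m', j') \<noteq> (m, j)"
    from pos_vert_other[OF this] have "pos m j u = pos m j v" using *(4) by auto
    with assms(2) show False by simp
  qed
  then show ?thesis using * by auto
qed

lemma mod_len: "t < len j \<Longrightarrow> Suc t mod len j = (if Suc t = len j then 0 else Suc t)"
  by auto

lemma height_arc: "(u, v) \<in> A \<Longrightarrow> height m v \<le> Suc (height m u)"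
  unfolding A_iff by (auto simp: height_vert)

lemma height_relpow: "(u, v) \<in> A ^^ n \<Longrightarrow> height m v \<le> height m u + n"
proof (induction n arbitrary: v)
  case (Suc n)
  then obtain w where w: "(u, w) \<in> A ^^ n" "(w, v) \<in> A" by auto
  then show ?case using Suc.IH[OF w(1)] height_arc[OF w(2), of m] by simp
qed auto

lemma sym_A: "sym A"
  unfolding sym_def A_iff by blast

lemma arc_vert: "m < M \<Longrightarrow> j < r \<Longrightarrow> t < len j \<Longrightarrow> (vert m j t, vert m j (Suc t mod len j)) \<in> A"
  unfolding A_iff by blast

lemma pair_graph_cactus: "pair_graph cactus_graph"
proof
  have inV: "u \<in> V \<and> v \<in> V" if uv: "(u, v) \<in> A" for u v
  proof -
    obtain m j t where *: "m < M" "j < r" "t < len j"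
      "(u, v) = (vert m j t, vert m j (Suc t mod len j)) \<or> (u, v) = (vert m j (Suc t mod len j), vert m j t)"
      using uv unfolding A_iff by blast
    then have "Suc t mod len j < len j" by simp
    then have "vert m j t \<in> V" "vert m j (Suc t mod len j) \<in> V"
      unfolding V_iff using * by blast+
    then show ?thesis using *(4) by auto
  qed
  then show "fst e \<in> V" "snd e \<in> V" if "e \<in> A" for e using that by (cases e; auto)+
  have "V \<subseteq> (\<lambda>(m, j, t). vert m j t) ` ({..<M} \<times> {..<r} \<times> {..<z})"
    unfolding V_iff subset_iff by (force simp: len_def)
  then show fV: "finite V" by (rule finite_subset) auto
  have "A \<subseteq> V \<times> V" using inV by auto
  then show "finite A" using fV by (meson finite_SigmaI finite_subset)
  show "symmetric (with_proj cactus_graph)" using sym_A by (simp add: symmetric_def)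
  show "fst e \<noteq> snd e" if e: "e \<in> A" for e
  proof
    assume eq: "fst e = snd e"
    obtain m j t where *: "m < M" "j < r" "t < len j"
      "e = (vert m j t, vert m j (Suc t mod len j)) \<or> e = (vert m j (Suc t mod len j), vert m j t)"
      using e A_iff[of "fst e" "snd e"] by auto
    then have "t = Suc t mod len j" using eq pos_vert by (metis fst_conv snd_conv)
    then show False using *(3) len_ge_3[OF *(2)] by (simp add: mod_len split: if_splits)
  qed
qed

sublocale pair_graph cactus_graph by (rule pair_graph_cactus)

lemma cyclic_relpow:
  "m < M \<Longrightarrow> j < r \<Longrightarrow> (vert m j (a mod len j), vert m j ((a + n) mod len j)) \<in> A ^^ n"
  using len_ge_3[of j] arc_vert by (intro relpow_cyclic) auto

lemma joint_relpow: "m < M \<Longrightarrow> j \<le> r \<Longrightarrow> (code 0 0 0, joint m j) \<in> A ^^ j"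
proof (induction j)
  case (Suc j)
  have "(joint m j, joint m (Suc j)) \<in> A"
    using arc_vert[of m j 0] Suc.prems len_ge_3[of j] by (simp add: joint_vert(1) joint_vert(2)[of m j])
  with Suc show ?case by auto
qed (simp add: joint_def)

lemma joint_in_V: "m < M \<Longrightarrow> j \<le> r \<Longrightarrow> joint m j \<in> V"
proof (cases j)
  case 0
  assume "m < M"
  then show ?thesis unfolding V_iff using 0 r len_ge_3[of 0]
    by (intro exI[of _ m] exI[of _ 0]) (simp add: joint_vert(2))
next
  case (Suc i)
  assume "m < M" "j \<le> r"
  then show ?thesis unfolding V_iff Suc joint_vert(1) using Suc len_ge_3[of i]
    by (intro exI[of _ m] exI[of _ i] exI[of _ 1]) auto
qed

text \<open>After \<open>j\<close> steps through the joints, the shorter way round cycle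
  \<open>j\<close> has at most \<open>r - j\<close> edges.\<close>

lemma near_centre:
  assumes "v \<in> V"
  shows "\<exists>n \<le> r. (code 0 0 0, v) \<in> A ^^ n"
proof -
  obtain m j t where v: "v = vert m j t" "m < M" "j < r" "t < len j"
    using assms unfolding V_iff by blast
  have "(code 0 0 0, vert m j 0) \<in> A ^^ j"
    using joint_relpow[of m j] v by (simp add: joint_vert(2)[of m j])
  moreover have "(vert m j 0, v) \<in> A ^^ t"
    using cyclic_relpow[of m j 0 t] v by simp
  moreover have "(v, vert m j 0) \<in> A ^^ (len j - t)"
    using cyclic_relpow[of m j t "len j - t"] v by simp
  then have "(vert m j 0, v) \<in> A ^^ (len j - t)" by (rule relpow_sym[OF sym_A])
  ultimately have "(code 0 0 0, v) \<in> A ^^ (j + t)" "(code 0 0 0, v) \<in> A ^^ (j + (len j - t))"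
    by (auto intro: relpow_appendI)
  moreover have "j + t \<le> r \<or> j + (len j - t) \<le> r"
    using v(3,4) by (auto simp: len_def min_def split: if_splits)
  ultimately show ?thesis by blast
qed

lemma centre_in_V: "code 0 0 0 \<in> V"
  using joint_in_V[of 0 0] M by (simp add: joint_def)

lemma reach: "u \<in> V \<Longrightarrow> v \<in> V \<Longrightarrow> (u, v) \<in> A\<^sup>*"
  using near_centre[of u] near_centre[of v] relpow_sym[OF sym_A]
  by (meson relpow_imp_rtrancl rtrancl_trans)

lemma connected_cactus: "connected (with_proj cactus_graph)"
  using connected_iff_rtrancl[OF sym_A] in_arcsD1 in_arcsD2 centre_in_V reach by blast

lemma bridgeless_cactus: "bridgeless_graph cactus_graph"
proof -
  have "\<not> bridge cactus_graph x y" for x y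
  proof
    assume b: "bridge cactus_graph x y"
    then have xy: "(x, y) \<in> A" by (simp add: bridge_def)
    let ?B = "A - {(x, y), (y, x)}"
    have symB: "sym ?B" using sym_A by (auto simp: sym_def)
    obtain m j t where *: "m < M" "j < r" "t < len j" and
      e: "(x, y) = (vert m j t, vert m j (Suc t mod len j)) \<or> (x, y) = (vert m j (Suc t mod len j), vert m j t)"
      using xy unfolding A_iff by blast
    let ?l = "len j"
    have l: "3 \<le> ?l" using len_ge_3 *(2) .
    \<comment> \<open>The other edges of the cycle lead from position \<open>t + 1\<close> round to
      \<open>t\<close>.\<close>
    have arc: "(vert m j ((Suc t + i) mod ?l), vert m j ((Suc t + Suc i) mod ?l)) \<in> ?B" if "i < ?l - 1" for i
    proof -
      let ?k = "(Suc t + i) mod ?l"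
      have k: "?k < ?l" using l by simp
      have "?k \<noteq> t"
        using that *(3) by (cases "Suc t + i < ?l") (auto simp: mod_if)
      then have "{?k, Suc ?k mod ?l} \<noteq> {t, Suc t mod ?l}"
        using cyclic_edge_inj[OF l k *(3)] by blast
      then have "{vert m j ?k, vert m j (Suc ?k mod ?l)} \<noteq> {vert m j t, vert m j (Suc t mod ?l)}"
        using pos_vert by (metis doubleton_eq_iff)
      then have "(vert m j ?k, vert m j (Suc ?k mod ?l)) \<notin> {(x, y), (y, x)}"
        using e by auto
      then show ?thesis using arc_vert[OF *(1,2) k] by (simp add: mod_Suc_eq)
    qed
    from relpow_chain[of "?l - 1" "\<lambda>i. vert m j ((Suc t + i) mod ?l)", OF this]
    have "(vert m j (Suc t mod ?l), vert m j ((Suc t + (?l - 1)) mod ?l)) \<in> ?B\<^sup>*"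
      by (simp add: relpow_imp_rtrancl)
    moreover have "(Suc t + (?l - 1)) mod ?l = t" using l *(3) by simp
    ultimately have yx: "(vert m j (Suc t mod ?l), vert m j t) \<in> ?B\<^sup>*" by simp
    then have "(vert m j t, vert m j (Suc t mod ?l)) \<in> ?B\<^sup>*"
      using sym_rtrancl[OF symB] by (meson symD)
    with yx have "(x, y) \<in> ?B\<^sup>*" using e by (metis prod.inject)
    then show False
      using b connected_remove_edge_iff[OF pair_graph_cactus xy connected_cactus] by (simp add: bridge_def)
  qed
  then show ?thesis
    unfolding bridgeless_graph_def using pair_graph_cactus connected_cactus by blast
qed

lemma wf: "pair_wf_digraph cactus_graph" ..

section \<open>Radius and isometric cycles of the extremal graph\<close>

lemma radius_cactus: "radius cactus_graph = r"
proof -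
  let ?ecc = "\<lambda>v. Max (gdist cactus_graph v ` V)"
  have fin: "finite V" by (rule pair_finite_verts)
  have "?ecc (code 0 0 0) \<le> r"
  proof (rule Max.boundedI)
    fix a assume "a \<in> gdist cactus_graph (code 0 0 0) ` V"
    then obtain v where v: "v \<in> V" "a = gdist cactus_graph (code 0 0 0) v" by blast
    obtain n where "n \<le> r" "(code 0 0 0, v) \<in> A ^^ n" using near_centre v(1) by blast
    then show "a \<le> r" using gdist_le[OF wf centre_in_V] v(2) le_trans by blast
  qed (use fin centre_in_V in auto)
  moreover have "r \<le> ?ecc v" if v: "v \<in> V" for v
  proof -
    \<comment> \<open>As there are at least two chains, \<open>v\<close> is at height 0 for one of
      them, whose end is then at distance at least \<open>r\<close>.\<close>
    obtain m where m: "m < M" "m \<noteq> chain_of v"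
      using M by (metis One_nat_def Suc_1 Suc_le_eq less_trans lessI zero_neq_one)
    have x: "joint m r \<in> V" using joint_in_V m(1) by simp
    have "height m v = 0" using m(2) by (simp add: height_def)
    moreover have "height m (joint m r) = r" using r by (simp add: height_def joint_def)
    ultimately have "r \<le> gdist cactus_graph v (joint m r)"
      using height_relpow[OF gdist_attained[OF wf v reach[OF v x]], of m] by simp
    then show ?thesis using Max_ge[of "gdist cactus_graph v ` V"] fin x by (meson finite_imageI imageI le_trans)
  qed
  ultimately show ?thesis
    unfolding radius_def using fin centre_in_V
    by (intro antisym) (auto intro!: Min.boundedI intro: Min.coboundedI[THEN le_trans])
qed

text \<open>One step moves the position by at most one around the cycle. The last two disjuncts
  cover the way round past position 0.\<close>

lemma pos_relpow:
  assumes j: "j < r" and "(u, v) \<in> A ^^ n"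
    and "pos m j u < len j"
  shows "pos m j v < len j \<and> (pos m j u \<le> pos m j v + n \<and> pos m j v \<le> pos m j u + n \<or>
    len j \<le> n + (pos m j v - pos m j u) \<or> len j \<le> n + (pos m j u - pos m j v))"
  using assms(2)
proof (induction n arbitrary: v)
  case (Suc n)
  then obtain w where w: "(u, w) \<in> A ^^ n" "(w, v) \<in> A" by auto
  note IH = Suc.IH[OF w(1)]
  show ?case
  proof (cases "pos m j w = pos m j v")
    case True
    then show ?thesis using IH by auto
  next
    case False
    then obtain i where i: "i < len j" "(w, v) = (vert m j i, vert m j (Suc i mod len j)) \<or>
        (w, v) = (vert m j (Suc i mod len j), vert m j i)"
      using pos_arc[OF w(2)] by blast
    then have "pos m j w = i \<and> pos m j v = Suc i mod len j \<or> pos m j w = Suc i mod len j \<and> pos m j v = i"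
      using pos_vert by auto
    then have "pos m j v = Suc (pos m j w) \<and> Suc (pos m j w) < len j \<or> pos m j w = Suc (pos m j v) \<or>
        Suc (pos m j w) = len j \<and> pos m j v = 0 \<or> pos m j w = 0 \<and> Suc (pos m j v) = len j"
      using i(1) unfolding mod_len[OF i(1)] by (auto split: if_splits)
    then show ?thesis using IH assms(3) by auto
  qed
qed (use assms in auto)

text \<open>Cycle 0 has length \<open>z\<close> because \<open>z \<le> 2 * r + 1\<close>, and is
  isometric by its retraction. Every cycle shares an edge with a cycle of some chain and is no
  longer than that one.\<close>

lemma iso_length_cactus: "iso_length cactus_graph = z"
proof (rule antisym)
  let ?w = "vert 0 0"
  have l: "len 0 = z" using z by (simp add: len_def)
  have inj: "inj_on ?w {..<z}" using pos_vert by (metis inj_onI)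
  have arcs: "(?w i, ?w (Suc i mod z)) \<in> A" if "i < z" for i
    using arc_vert[of 0 0 i] that l M r by simp
  have far: "j - i \<le> n \<or> z - (j - i) \<le> n" if "i \<le> j" "j < z" "(?w i, ?w j) \<in> A ^^ n" for i j n
    using pos_relpow[of 0 "?w i" "?w j" n 0] that r l by (auto simp: pos_vert)
  have "z = length (cyclic_walk ?w z)" by simp
  also have "\<dots> \<le> iso_length cactus_graph"
    using z(1) by (intro iso_length_ge[OF pair_graph_cactus cycle_cyclic_walk[OF wf _ inj arcs]
        _ isometric_cyclic_walk[OF pair_graph_cactus _ inj arcs far]]) auto
  finally show "z \<le> iso_length cactus_graph" .
  have short: "length p \<le> z" if p: "cycle p" "3 \<le> length p" for p
  proof -
    have "set p \<subseteq> A" using p(1) unfolding cycle_conv by auto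
    moreover have "hd p \<in> set p" using p(2) by (intro hd_in_set) auto
    ultimately obtain m j t where e: "m < M" "j < r" "t < len j"
      "(vert m j t, vert m j (Suc t mod len j)) \<in> set p \<or> (vert m j (Suc t mod len j), vert m j t) \<in> set p"
      using A_iff[of "fst (hd p)" "snd (hd p)"] by (metis prod.collapse subsetD)
    have "length p \<le> len j"
      using cycle_through_retract_edge[OF wf p, where pos = "pos m j" and w = "vert m j", OF pos_vert pos_arc e(3,4)] .
    then show ?thesis by (simp add: len_def)
  qed
  show "iso_length cactus_graph \<le> z"
  proof -
    let ?S = "{length p |p. cycle p \<and> 3 \<le> length p \<and> isometric_subgraph (cycle_graph p) cactus_graph}"
    have "length (cyclic_walk ?w z) \<in> ?S"
      using z(1) cycle_cyclic_walk[OF wf _ inj arcs] isometric_cyclic_walk[OF pair_graph_cactus _ inj arcs far]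
      by force
    then have "?S \<noteq> {}" by blast
    then show ?thesis unfolding iso_length_def by (rule cSup_least) (use short in auto)
  qed
qed

section \<open>Counting colours in the extremal graph\<close>

text \<open>A slot \<open>(j, t)\<close> names edge number \<open>t\<close> of cycle
  \<open>j\<close> in all chains at once.\<close>

definition slots :: "(nat \<times> nat) set" where
  "slots = (SIGMA j:{..<r}. {..<len j})"

lemma card_slots: "card slots = (\<Sum>i=1..r. min (2 * i + 1) z)"
proof -
  have "card slots = (\<Sum>j<r. len j)" by (simp add: slots_def)
  also have "\<dots> = (\<Sum>i=1..r. min (2 * i + 1) z)"
    by (rule sum.reindex_bij_witness[of _ "\<lambda>i. r - i" "\<lambda>j. r - j"]) (auto simp: len_def)
  finally show ?thesis .
qed

definition edge :: "nat \<Rightarrow> nat \<times> nat \<Rightarrow> nat set" where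
  "edge m s = {vert m (fst s) (snd s), vert m (fst s) (Suc (snd s) mod len (fst s))}"

lemma edge_in_edges: "m < M \<Longrightarrow> s \<in> slots \<Longrightarrow> edge m s \<in> edges cactus_graph"
  using arc_vert unfolding edges_def edge_def slots_def by force

text \<open>\<open>pos m j\<close> separates the ends of an edge of its own cycle and identifies
  those of every other edge.\<close>

lemma edge_inj:
  assumes "s \<in> slots" "s' \<in> slots" "edge m s = edge m' s'"
  shows "m = m' \<and> s = s'"
proof -
  obtain j t j' t' where s: "s = (j, t)" "s' = (j', t')" by (meson surj_pair)
  have l: "3 \<le> len j" "t < len j" "t' < len j'" using assms s len_ge_3 by (auto simp: slots_def)
  have "pos m j ` edge m s = {t, Suc t mod len j}" by (simp add: edge_def s pos_vert)
  moreover have "t \<noteq> Suc t mod len j" using l by (simp add: mod_len)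
  moreover have "pos m j ` edge m' s' = {if m' = m \<and> j < j' then 1 else 0}" if "(m', j') \<noteq> (m, j)"
    using pos_vert_other[OF that] by (simp add: edge_def s)
  ultimately have mj: "(m', j') = (m, j)" using assms(3) by (metis doubleton_eq_iff insert_absorb2)
  then have "pos m j ` edge m' s' = {t', Suc t' mod len j}" by (simp add: edge_def s pos_vert)
  then have "{t, Suc t mod len j} = {t', Suc t' mod len j}"
    using \<open>pos m j ` edge m s = _\<close> assms(3) by simp
  then have "t = t'" using cyclic_edge_inj l mj by blast
  with mj s show ?thesis by simp
qed

text \<open>The edges \<open>(j, 0)\<close> and \<open>(j, t)\<close> of a chain form a cut between the end of the chain and
  everything outside of the chain.\<close>

lemma walk_uses_edge:
  assumes p: "awalk u p v" and sep: "u = joint m r \<and> chain_of v \<noteq> m \<or> v = joint m r \<and> chain_of u \<noteq> m"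
    and "m < M" "j < r" "t < len j" "t \<noteq> 0"
  shows "\<exists>i. (i = 0 \<or> i = t) \<and> edge m (j, i) \<in> (\<lambda>(x, y). {x, y}) ` set p"
proof -
  \<comment> \<open>The end of the chain is at position 1 and the other chains at position 0; edges
    0 and \<open>t\<close> form the boundary of \<open>T\<close>.\<close>
  define T where "T = {x. pos m j x \<noteq> 0 \<and> pos m j x \<le> t}"
  have inT: "joint m r \<in> T" using assms(4,6) by (auto simp: T_def pos_def joint_def)
  have notT: "x \<notin> T" if "chain_of x \<noteq> m" for x using that by (simp add: T_def pos_def)
  have "\<exists>x y. (x, y) \<in> set p \<and> (x \<in> T) \<noteq> (y \<in> T)"
    using sep
  proof
    assume "u = joint m r \<and> chain_of v \<noteq> m"
    then show ?thesis using awalk_crosses[OF wf p, of T] inT notT by blast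
  next
    assume "v = joint m r \<and> chain_of u \<noteq> m"
    then show ?thesis using awalk_crosses[OF wf p, of "- T"] inT notT by blast
  qed
  then obtain x y where xy: "(x, y) \<in> set p" "(x \<in> T) \<noteq> (y \<in> T)" by blast
  then have "(x, y) \<in> A" "pos m j x \<noteq> pos m j y" using p by (auto simp: T_def)
  then obtain i where i: "i < len j" "(x, y) = (vert m j i, vert m j (Suc i mod len j)) \<or>
      (x, y) = (vert m j (Suc i mod len j), vert m j i)"
    using pos_arc by blast
  then have "(vert m j i \<in> T) \<noteq> (vert m j (Suc i mod len j) \<in> T)" using xy(2) by auto
  then have "i = 0 \<or> i = t"
    using i(1) assms(5) by (auto simp: T_def pos_vert mod_len split: if_splits)
  moreover have "edge m (j, i) = {x, y}" using i(2) by (auto simp: edge_def)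
  ultimately show ?thesis using xy(1) by force
qed

text \<open>With fewer than \<open>?N\<close> colours a chain has at most \<open>?N ^ ?N\<close>
  colour patterns, so two chains are coloured alike. A rainbow path between their ends then forces
  \<open>?N\<close> distinct colours.\<close>

lemma rainbow_needs_all_colours:
  assumes c: "rainbow_colouring cactus_graph c"
    and M_large: "(\<Sum>i=1..r. min (2 * i + 1) z) ^ (\<Sum>i=1..r. min (2 * i + 1) z) < M"
  shows "(\<Sum>i=1..r. min (2 * i + 1) z) \<le> card (c ` edges cactus_graph)"
proof (rule ccontr)
  let ?N = "\<Sum>i=1..r. min (2 * i + 1) z"
  let ?F = "c ` edges cactus_graph"
  assume less: "\<not> ?N \<le> card ?F"
  have fin: "finite slots" "finite ?F"
    using pair_finite_arcs by (auto simp: slots_def edges_def)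
  define \<phi> where "\<phi> m = restrict (\<lambda>s. c (edge m s)) slots" for m
  have "\<phi> ` {..<M} \<subseteq> slots \<rightarrow>\<^sub>E ?F"
    using edge_in_edges by (auto simp: \<phi>_def)
  moreover have "card (slots \<rightarrow>\<^sub>E ?F) = card ?F ^ ?N"
    by (simp only: card_PiE[OF fin(1)] prod_constant card_slots)
  moreover have "card ?F ^ ?N \<le> ?N ^ ?N" using less by (intro power_mono) auto
  moreover have "finite (slots \<rightarrow>\<^sub>E ?F)" using fin by (intro finite_PiE) auto
  ultimately have "\<not> inj_on \<phi> {..<M}"
    using M_large card_inj_on_le[of \<phi> "{..<M}" "slots \<rightarrow>\<^sub>E ?F"] by auto
  then obtain m m' where m: "m < M" "m' < M" "m \<noteq> m'" "\<phi> m = \<phi> m'"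
    by (auto simp: inj_on_def)
  have same: "c (edge m s) = c (edge m' s)" if "s \<in> slots" for s
    using m(4) that by (metis \<phi>_def restrict_apply')
  have V: "joint m r \<in> V" "joint m' r \<in> V" using joint_in_V m by auto
  obtain p where p: "apath (joint m r) p (joint m' r)" "distinct (map (\<lambda>(x, y). c {x, y}) p)"
    using c V unfolding rainbow_colouring_def rainbow_path_def by blast
  let ?E = "(\<lambda>(x, y). {x, y}) ` set p"
  have chain: "chain_of (joint m r) = m" "chain_of (joint m' r) = m'" using r by (auto simp: joint_def)
  have awalk: "awalk (joint m r) p (joint m' r)" using p(1) by (simp add: apath_def)
  have inj: "inj_on c ?E"
  proof (rule inj_onI)
    fix e e' assume e: "e \<in> ?E" "e' \<in> ?E" "c e = c e'"
    obtain x y where x: "(x, y) \<in> set p" "e = {x, y}" using e(1) by auto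
    obtain x' y' where x': "(x', y') \<in> set p" "e' = {x', y'}" using e(2) by auto
    have "inj_on (\<lambda>(x, y). c {x, y}) (set p)" using p(2) by (simp add: distinct_map)
    from inj_onD[OF this _ x(1) x'(1)] have "(x, y) = (x', y')" using e(3) x x' by simp
    then show "e = e'" using x x' by simp
  qed
  have once: "\<not> (edge m s \<in> ?E \<and> edge m' s \<in> ?E)" if "s \<in> slots" for s
  proof
    assume "edge m s \<in> ?E \<and> edge m' s \<in> ?E"
    then have "edge m s = edge m' s" by (intro inj_onD[OF inj same[OF that]]) simp_all
    then show False using edge_inj[OF that that] m(3) by simp
  qed
  have used: "edge m s \<in> ?E \<or> edge m' s \<in> ?E" if s: "s \<in> slots" for s
  proof -
    obtain j t where jt: "s = (j, t)" "j < r" "t < len j" using s by (auto simp: slots_def)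
    have slot: "(j, i) \<in> slots" if "i < len j" for i using that jt(2) by (simp add: slots_def)
    have 1: "edge m (j, 0) \<in> ?E \<or> edge m (j, i) \<in> ?E" if "i < len j" "i \<noteq> 0" for i
      using walk_uses_edge[OF awalk, of m j i] chain m jt(2) that by auto
    have 2: "edge m' (j, 0) \<in> ?E \<or> edge m' (j, i) \<in> ?E" if "i < len j" "i \<noteq> 0" for i
      using walk_uses_edge[OF awalk, of m' j i] chain m jt(2) that by auto
    have one: "1 < len j" using len_ge_3[OF jt(2)] by simp
    \<comment> \<open>If edge 0 were used in neither chain, the cuts would force edge 1 in
      both.\<close>
    have zero: "edge m (j, 0) \<in> ?E \<or> edge m' (j, 0) \<in> ?E"
      using 1[OF one one_neq_zero] 2[OF one one_neq_zero] once[OF slot[OF one]] by blast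
    show ?thesis
    proof (cases "t = 0")
      case True
      then show ?thesis using zero jt(1) by simp
    next
      case False
      \<comment> \<open>Edge 0 is used in only one of the two chains, and in the other one the cut
        forces edge \<open>t\<close>.\<close>
      have "0 < len j" using one by simp
      from once[OF slot[OF this]] show ?thesis
        using 1[OF jt(3) False] 2[OF jt(3) False] zero unfolding jt(1) by argo
    qed
  qed
  \<comment> \<open>Each slot is represented on the path by an edge of the same colour, in one chain
    or the other.\<close>
  have "inj_on (\<lambda>s. c (edge m s)) slots"
  proof (rule inj_onI)
    fix s s' assume s: "s \<in> slots" "s' \<in> slots" "c (edge m s) = c (edge m s')"
    obtain a where a: "a = m \<or> a = m'" "edge a s \<in> ?E"
      using used[OF s(1)] that[of m] that[of m'] by argo
    obtain b where b: "b = m \<or> b = m'" "edge b s' \<in> ?E"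
      using used[OF s(2)] that[of m] that[of m'] by argo
    have "c (edge a s) = c (edge m s)" using a(1) same[OF s(1)] by (elim disjE) simp_all
    moreover have "c (edge b s') = c (edge m s')" using b(1) same[OF s(2)] by (elim disjE) simp_all
    ultimately have "c (edge a s) = c (edge b s')" using s(3) by simp
    then have "edge a s = edge b s'" by (rule inj_onD[OF inj _ a(2) b(2)])
    then show "s = s'" using edge_inj[OF s(1,2)] by simp
  qed
  moreover have "(\<lambda>s. c (edge m s)) ` slots \<subseteq> ?F" using edge_in_edges m(1) by auto
  ultimately have "card slots \<le> card ?F" using fin(2) by (intro card_inj_on_le)
  then show False using less card_slots by simp
qed

end

theorem theorem1:
  shows "(\<forall>(G :: 'a pair_pre_digraph) r \<zeta>. bridgeless_graph G \<and> radius G = r \<and> iso_length G = \<zeta> \<longrightarrow>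
            rc G \<le> (\<Sum>i=1..r. min (2 * i + 1) \<zeta>) \<and>
            (\<Sum>i=1..r. min (2 * i + 1) \<zeta>) \<le> r * \<zeta>) \<and>
         (\<forall>r \<zeta> :: nat. 1 \<le> r \<and> 3 \<le> \<zeta> \<and> \<zeta> \<le> 2 * r + 1 \<longrightarrow>
            (\<exists>G :: nat pair_pre_digraph. bridgeless_graph G \<and> radius G = r \<and> iso_length G = \<zeta> \<and>
               rc G = (\<Sum>i=1..r. min (2 * i + 1) \<zeta>)))"
proof -
  \<comment> \<open>Stated for a fresh type \<open>'b\<close>, as it is applied both at
    \<open>'a\<close> and at \<open>nat\<close>.\<close>
  have rc_le: "rc G \<le> (\<Sum>i=1..radius G. min (2 * i + 1) (iso_length G))"
    if G: "bridgeless_graph G" for G :: "'b pair_pre_digraph"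
  proof -
    obtain c where c: "rainbow_colouring G c"
      "card (c ` edges G) \<le> (\<Sum>i=1..radius G. min (2 * i + 1) (iso_length G))"
      using rc_upper_bound[OF G] by blast
    have "rc G \<le> card (c ` edges G)"
      unfolding rc_def by (rule Least_le) (use c(1) in blast)
    with c(2) show ?thesis by simp
  qed
  have sum_le: "(\<Sum>i=1..r. min (2 * i + 1) \<zeta>) \<le> r * \<zeta>" for r \<zeta> :: nat
    using sum_bounded_above[of "{1..r}" "\<lambda>i. min (2 * i + 1) \<zeta>" \<zeta>] by simp
  have "\<exists>G :: nat pair_pre_digraph. bridgeless_graph G \<and> radius G = r \<and> iso_length G = \<zeta> \<and>
      rc G = (\<Sum>i=1..r. min (2 * i + 1) \<zeta>)"
    if "1 \<le> r" "3 \<le> \<zeta>" "\<zeta> \<le> 2 * r + 1" for r \<zeta> :: nat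
  proof -
    let ?N = "\<Sum>i=1..r. min (2 * i + 1) \<zeta>"
    \<comment> \<open>The number of chains exceeds the number \<open>?N ^ ?N\<close> of colour
      patterns and is at least 2.\<close>
    interpret cactus r \<zeta> "?N ^ ?N + 2" by unfold_locales (use that in auto)
    have "\<exists>k c. rainbow_colouring cactus_graph c \<and> card (c ` edges cactus_graph) = k"
      using rc_upper_bound[OF bridgeless_cactus] by blast
    then have "\<exists>c. rainbow_colouring cactus_graph c \<and> card (c ` edges cactus_graph) = rc cactus_graph"
      unfolding rc_def by (rule LeastI_ex)
    then have "?N \<le> rc cactus_graph" using rainbow_needs_all_colours by fastforce
    moreover have "rc cactus_graph \<le> ?N"
      using rc_le[OF bridgeless_cactus] unfolding radius_cactus iso_length_cactus .
    ultimately show ?thesis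
      using bridgeless_cactus radius_cactus iso_length_cactus by (intro exI[of _ cactus_graph]) simp
  qed
  then show ?thesis using rc_le sum_le by blast
qed

end
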